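(* Let $(X_i,D_i,Y_i^T,Y_i^C)$, $i=1,\dots,n$, be i.i.d. copies of $(X,D,Y^T,Y^C)$ with $X\in\mathbb{R}^K$, $D\in\{0,1\}$, and $Y_i=D_iY_i^T+(1-D_i)Y_i^C$. Assume unconfoundedness, $(Y^T,Y^C)\perp D\mid X$; overlap, $0<p(X)<1$ a.s., where $p(X)=\mathbf{P}(D=1\mid X)$; and that the function $p(\cdot)$ is known. Suppose there exist $a,b\in\mathbb{R}$ and $c\in\mathbb{R}^K$ such that $$\mathbf{E}[Y^T\mid X]=a+b+c^TX,\qquad \mathbf{E}[Y^C\mid X]=a+c^TX.$$ Then the linearly modified estimator $\tilde\beta_{lm}$ (defined in the context) of $\beta=\mathbf{E}Y^T-\mathbf{E}Y^C$ is asymptotically efficient, i.e. its asymptotic variance equals the semi-parametric efficiency bound $$\mathbf{E}\left[\frac{\sigma_T^2(X)}{p(X)}+\frac{\sigma_C^2(X)}{1-p(X)}+(\beta(X)-\beta)^2\right].$$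
   Context: Notation: $\beta(X)=\mathbf{E}[Y^T\mid X]-\mathbf{E}[Y^C\mid X]$, $\sigma_T^2(X)=\mathbf{var}(Y^T\mid X)$, $\sigma_C^2(X)=\mathbf{var}(Y^C\mid X)$, $\bar X=\frac1n\sum_{i=1}^nX_i$. Estimators: $$\tilde\beta_{ipw}=\frac{\sum_{i=1}^n D_iY_i/p(X_i)}{\sum_{i=1}^n D_i/p(X_i)}-\frac{\sum_{i=1}^n(1-D_i)Y_i/(1-p(X_i))}{\sum_{i=1}^n(1-D_i)/(1-p(X_i))},$$ $$\tilde x_{ipw}=\frac{\sum_{i=1}^n D_iX_i/p(X_i)}{\sum_{i=1}^n D_i/p(X_i)}-\frac{\sum_{i=1}^n(1-D_i)X_i/(1-p(X_i))}{\sum_{i=1}^n(1-D_i)/(1-p(X_i))}\in\mathbb{R}^K,$$ and $\tilde\beta_{lm}=\tilde\beta_{ipw}-\hat\alpha^T\tilde x_{ipw}$ with $\hat\alpha=\hat A^{-1}\hat b$, where $$\hat A=\frac1n\sum_{i=1}^n\frac{(X_i-\bar X)(X_i-\bar X)^T}{p(X_i)(1-p(X_i))},$$ $$\hat b=\frac1n\sum_{j=1}^n(X_j-\bar X)\left(\frac{D_j}{p(X_j)^2}\Big(Y_j^T-\frac1n\sum_{i=1}^n\frac{D_iY_i}{p(X_i)}\Big)+\frac{1-D_j}{(1-p(X_j))^2}\Big(Y_j^C-\frac1n\sum_{i=1}^n\frac{(1-D_i)Y_i}{1-p(X_i)}\Big)\right).$$ (The estimators are defined on the event that denominators are nonzero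 and $\hat A$ is invertible; they may be set to arbitrary values elsewhere.) The asymptotic variance of $\tilde\beta_{lm}$ is the variance of the centered normal limit in law of $\sqrt n(\tilde\beta_{lm}-\beta)$. Implicit regularity so that all quantities make sense: $\mathbf{E}\big[\frac{1+\|X\|^2}{p(X)(1-p(X))}\big]<\infty$, $\mathbf{E}[(Y^T)^2/p(X)]<\infty$, $\mathbf{E}[(Y^C)^2/(1-p(X))]<\infty$, and the matrix $\mathbf{E}\big[\frac{1}{p(X)(1-p(X))}(X-\mathbf{E}X)(X-\mathbf{E}X)^T\big]$ is invertible. *)

theory Defs
  imports "HOL-Probability.Probability"
begin

abbreviation cexp :: "'a measure \<Rightarrow> ('a \<Rightarrow> real^'k) \<Rightarrow> ('a \<Rightarrow> real) \<Rightarrow> 'a \<Rightarrow> real" where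
  "cexp M X Z \<equiv> real_cond_exp M (vimage_algebra (space M) X borel) Z"

definition cprob :: "'a measure \<Rightarrow> ('a \<Rightarrow> real^'k) \<Rightarrow> 'a set \<Rightarrow> 'a \<Rightarrow> real" where
  "cprob M X E = cexp M X (indicator E)"

definition cvar :: "'a measure \<Rightarrow> ('a \<Rightarrow> real^'k) \<Rightarrow> ('a \<Rightarrow> real) \<Rightarrow> 'a \<Rightarrow> real" where
  "cvar M X Z = cexp M X (\<lambda>\<omega>. (Z \<omega> - cexp M X Z \<omega>)\<^sup>2)"

definition cond_indep ::
  "'a measure \<Rightarrow> ('a \<Rightarrow> real^'k) \<Rightarrow> ('a \<Rightarrow> 'u::topological_space) \<Rightarrow> ('a \<Rightarrow> 'v::topological_space) \<Rightarrow> bool"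
where
  "cond_indep M X U V \<longleftrightarrow>
     (\<forall>A\<in>sets borel. \<forall>B\<in>sets borel. AE \<omega> in M.
        cprob M X {\<omega>\<in>space M. U \<omega> \<in> A \<and> V \<omega> \<in> B} \<omega> =
        cprob M X {\<omega>\<in>space M. U \<omega> \<in> A} \<omega> * cprob M X {\<omega>\<in>space M. V \<omega> \<in> B} \<omega>)"

definition iid_copies ::
  "'a measure \<Rightarrow> 'b measure \<Rightarrow> (nat \<Rightarrow> 'a \<Rightarrow> 'b) \<Rightarrow> ('a \<Rightarrow> 'b) \<Rightarrow> bool" where
  "iid_copies M N Zs Z \<longleftrightarrow>
     prob_space.indep_vars M (\<lambda>_. N) Zs UNIV \<and> (\<forall>i. distr M N (Zs i) = distr M N Z)"

text \<open>The normal law with mean 0 and variance \<open>V \<ge> 0\<close>; for \<open>V = 0\<close> it is the point mass at 0.\<close>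

definition centered_normal :: "real \<Rightarrow> real measure" where
  "centered_normal V = distr std_normal_distribution borel (\<lambda>x. sqrt V * x)"

definition has_asymptotic_variance ::
  "'a measure \<Rightarrow> (nat \<Rightarrow> 'a \<Rightarrow> real) \<Rightarrow> real \<Rightarrow> real \<Rightarrow> bool" where
  "has_asymptotic_variance M T \<theta> V \<longleftrightarrow>
     0 \<le> V \<and> (\<forall>n. T n \<in> borel_measurable M) \<and>
     weak_conv_m (\<lambda>n. distr M borel (\<lambda>\<omega>. sqrt (real n) * (T n \<omega> - \<theta>))) (centered_normal V)"

text \<open>
  The estimators are functions of the data: the sample of size \<open>n\<close> consists of the entries
  with index \<open>i < n\<close> of the sequences \<open>x\<close>, \<open>d\<close>, \<open>yT\<close>, \<open>yC\<close>, and \<open>p\<close> is the known propensity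
  score.  Where a denominator vanishes or the matrix \<open>A_hat\<close> is singular, the values are those
  given by \<open>inverse 0 = 0\<close> and by the totalised \<open>matrix_inv\<close>.
\<close>

definition observed :: "(nat \<Rightarrow> real) \<Rightarrow> (nat \<Rightarrow> real) \<Rightarrow> (nat \<Rightarrow> real) \<Rightarrow> nat \<Rightarrow> real" where
  "observed d yT yC i = d i * yT i + (1 - d i) * yC i"

text \<open>With \<open>z\<close> the observed outcomes this is the estimator \<open>\<beta>\<close> with index ipw; with \<open>z = x\<close> it is
  the vector \<open>x\<close> with index ipw.\<close>

definition ipw ::
  "(real^'k \<Rightarrow> real) \<Rightarrow> nat \<Rightarrow> (nat \<Rightarrow> real^'k) \<Rightarrow> (nat \<Rightarrow> real) \<Rightarrow> (nat \<Rightarrow> 'v) \<Rightarrow> 'v::real_vector" where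
  "ipw p n x d z =
     (\<Sum>i<n. (d i / p (x i)) *\<^sub>R z i) /\<^sub>R (\<Sum>i<n. d i / p (x i)) -
     (\<Sum>i<n. ((1 - d i) / (1 - p (x i))) *\<^sub>R z i) /\<^sub>R (\<Sum>i<n. (1 - d i) / (1 - p (x i)))"

definition sample_mean :: "nat \<Rightarrow> (nat \<Rightarrow> 'v) \<Rightarrow> 'v::real_vector" where
  "sample_mean n z = (\<Sum>i<n. z i) /\<^sub>R real n"

definition outer :: "real^'k \<Rightarrow> real^'k^'k" where
  "outer v = (\<chi> i j. v $ i * v $ j)"

definition A_hat :: "(real^'k \<Rightarrow> real) \<Rightarrow> nat \<Rightarrow> (nat \<Rightarrow> real^'k) \<Rightarrow> real^'k^'k" where
  "A_hat p n x =
     sample_mean n (\<lambda>i. outer (x i - sample_mean n x) /\<^sub>R (p (x i) * (1 - p (x i))))"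

definition b_hat ::
  "(real^'k \<Rightarrow> real) \<Rightarrow> nat \<Rightarrow> (nat \<Rightarrow> real^'k) \<Rightarrow> (nat \<Rightarrow> real) \<Rightarrow> (nat \<Rightarrow> real) \<Rightarrow> (nat \<Rightarrow> real) \<Rightarrow> real^'k"
where
  "b_hat p n x d yT yC =
     sample_mean n (\<lambda>j.
       (d j / (p (x j))\<^sup>2 *
          (yT j - sample_mean n (\<lambda>i. d i * observed d yT yC i / p (x i))) +
        (1 - d j) / (1 - p (x j))\<^sup>2 *
          (yC j - sample_mean n (\<lambda>i. (1 - d i) * observed d yT yC i / (1 - p (x i)))))
       *\<^sub>R (x j - sample_mean n x))"

definition alpha_hat ::
  "(real^'k \<Rightarrow> real) \<Rightarrow> nat \<Rightarrow> (nat \<Rightarrow> real^'k) \<Rightarrow> (nat \<Rightarrow> real) \<Rightarrow> (nat \<Rightarrow> real) \<Rightarrow> (nat \<Rightarrow> real) \<Rightarrow> real^'k"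
where
  "alpha_hat p n x d yT yC = matrix_inv (A_hat p n x) *v b_hat p n x d yT yC"

definition beta_lm ::
  "(real^'k \<Rightarrow> real) \<Rightarrow> nat \<Rightarrow> (nat \<Rightarrow> real^'k) \<Rightarrow> (nat \<Rightarrow> real) \<Rightarrow> (nat \<Rightarrow> real) \<Rightarrow> (nat \<Rightarrow> real) \<Rightarrow> real"
where
  "beta_lm p n x d yT yC =
     ipw p n x d (observed d yT yC) - alpha_hat p n x d yT yC \<bullet> ipw p n x d x"

definition avg_effect :: "'a measure \<Rightarrow> ('a \<Rightarrow> real) \<Rightarrow> ('a \<Rightarrow> real) \<Rightarrow> real" where
  "avg_effect M YT YC = integral\<^sup>L M YT - integral\<^sup>L M YC"

definition efficiency_integrand ::
  "'a measure \<Rightarrow> (real^'k \<Rightarrow> real) \<Rightarrow> ('a \<Rightarrow> real^'k) \<Rightarrow> ('a \<Rightarrow> real) \<Rightarrow> ('a \<Rightarrow> real) \<Rightarrow> 'a \<Rightarrow> real"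
where
  "efficiency_integrand M p X YT YC \<omega> =
     cvar M X YT \<omega> / p (X \<omega>) + cvar M X YC \<omega> / (1 - p (X \<omega>)) +
     ((cexp M X YT \<omega> - cexp M X YC \<omega>) - avg_effect M YT YC)\<^sup>2"

definition efficiency_bound ::
  "'a measure \<Rightarrow> (real^'k \<Rightarrow> real) \<Rightarrow> ('a \<Rightarrow> real^'k) \<Rightarrow> ('a \<Rightarrow> real) \<Rightarrow> ('a \<Rightarrow> real) \<Rightarrow> real"
where
  "efficiency_bound M p X YT YC = integral\<^sup>L M (efficiency_integrand M p X YT YC)"

end

theory Submission
  imports Defs
begin

text \<open>
  Since the two regressions are \<open>\<alpha> + c \<bullet> X\<close> with the same slope \<open>c\<close>, writing \<open>e\<close> for the regression
  residuals and \<open>m\<close> for the empirical means of the inverse propensity weights gives the exact identity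
  \<open>\<beta>\<^sub>l\<^sub>m - \<beta> = mean (D e\<^sub>T / p) / m\<^sub>T - mean ((1 - D) e\<^sub>C / (1 - p)) / m\<^sub>C + (c - \<alpha>_hat) \<bullet> x\<^sub>i\<^sub>p\<^sub>w\<close>.
  By the law of large numbers \<open>m\<^sub>T\<close> and \<open>m\<^sub>C\<close> tend to 1, \<open>A_hat\<close> tends to the invertible matrix \<open>A\<close> and \<open>b_hat\<close>
  to \<open>A c\<close>, so \<open>\<alpha>_hat\<close> tends to \<open>c\<close>; as \<open>sqrt n * x\<^sub>i\<^sub>p\<^sub>w\<close> is bounded in probability, the last term is
  negligible after scaling by \<open>sqrt n\<close>. The central limit theorem for \<open>D e\<^sub>T / p - (1 - D) e\<^sub>C / (1 - p)\<close>, whose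
  variance is \<open>E (\<sigma>\<^sub>T\<^sup>2 / p + \<sigma>\<^sub>C\<^sup>2 / (1 - p))\<close> because the cross term vanishes, then gives the limit law. This is the
  efficiency bound, as the conditional treatment effect is constant.
\<close>

section \<open>Convergence in probability\<close>

text \<open>The moment assumptions make the summands of \<open>A_hat\<close> and
  \<open>b_hat\<close> integrable but no more: the square of \<open>D * Y * X / p^2\<close> has a
  mean that involves \<open>1 / p^3\<close>. So the weak law has to work under integrability alone,
  and \<open>alpha_hat\<close>, which inverts a random matrix, comes without moment bounds and
  without a rate. Convergence without a rate suffices because the inverse propensity contrast of the
  covariates is already of order \<open>1 / sqrt n\<close>: normalised weights allow both averages
  to be centred at the common mean of \<open>X\<close>, and the weighted centred covariates have
  finite second moments. Every error term is therefore arranged as a factor with bounded second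
  moment times a factor that merely tends to zero in probability. The exact identity needs both
  weight means to be nonzero; the exceptional event has vanishing probability, and on it only the
  measurability of the totalised expressions matters.\<close>

definition tendsto_prob ::
  "'a measure \<Rightarrow> (nat \<Rightarrow> 'a \<Rightarrow> 'b::{metric_space, second_countable_topology}) \<Rightarrow> 'b \<Rightarrow> bool" where
  "tendsto_prob M X c \<longleftrightarrow> (\<forall>n. X n \<in> borel_measurable M) \<and>
     (\<forall>e>0. (\<lambda>n. measure M {\<omega>\<in>space M. e \<le> dist (X n \<omega>) c}) \<longlonglongrightarrow> 0)"

lemma tendsto_prob_measurable: "tendsto_prob M X c \<Longrightarrow> X n \<in> borel_measurable M"
  by (simp add: tendsto_prob_def)

context prob_space
begin

text \<open>The common engine of all continuous mapping arguments: up to a null set, the event that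
  \<open>Z n\<close> is far from \<open>l\<close> lies in a finite union of events that some input
  is far from its limit. Asking for the implication only almost surely and for late \<open>n\<close>
  admits identities that fail on null sets or at \<open>n = 0\<close>.\<close>

lemma tendsto_prob_compose_finite:
  assumes "finite I"
    and X: "\<And>i. i \<in> I \<Longrightarrow> tendsto_prob M (X i) (a i)"
    and Z[measurable]: "\<And>n. Z n \<in> borel_measurable M"
    and ev: "\<And>e. e > 0 \<Longrightarrow> \<exists>d>0. \<forall>\<^sub>F n in sequentially. AE \<omega> in M.
        (\<forall>i\<in>I. dist (X i n \<omega>) (a i) < d) \<longrightarrow> dist (Z n \<omega>) l < e"
  shows "tendsto_prob M Z l"
  unfolding tendsto_prob_def
proof (intro conjI allI impI)
  fix e :: real assume "e > 0"
  from ev[OF this] obtain d where d: "d > 0"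
    and AEd: "\<forall>\<^sub>F n in sequentially. AE \<omega> in M. (\<forall>i\<in>I. dist (X i n \<omega>) (a i) < d) \<longrightarrow> dist (Z n \<omega>) l < e"
    by blast
  let ?B = "\<lambda>i n. {\<omega>\<in>space M. d \<le> dist (X i n \<omega>) (a i)}"
  have meas: "?B i n \<in> sets M" if "i \<in> I" for i n
    using tendsto_prob_measurable[OF X[OF that], of n] by measurable
  have bound: "\<forall>\<^sub>F n in sequentially.
      prob {\<omega>\<in>space M. e \<le> dist (Z n \<omega>) l} \<le> (\<Sum>i\<in>I. prob (?B i n))"
    using AEd
  proof eventually_elim
    case (elim n)
    have "prob {\<omega>\<in>space M. e \<le> dist (Z n \<omega>) l} \<le> prob (\<Union>i\<in>I. ?B i n)"
    proof (rule finite_measure_mono_AE)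
      show "AE \<omega> in M. \<omega> \<in> {\<omega>\<in>space M. e \<le> dist (Z n \<omega>) l} \<longrightarrow> \<omega> \<in> (\<Union>i\<in>I. ?B i n)"
        using elim by eventually_elim (force simp: not_less)
    qed (use meas \<open>finite I\<close> in auto)
    also have "\<dots> \<le> (\<Sum>i\<in>I. prob (?B i n))"
      using meas \<open>finite I\<close> by (intro finite_measure_subadditive_finite) auto
    finally show ?case .
  qed
  have lim: "(\<lambda>n. \<Sum>i\<in>I. prob (?B i n)) \<longlonglongrightarrow> 0"
    using X d by (intro tendsto_null_sum) (auto simp: tendsto_prob_def)
  show "(\<lambda>n. prob {\<omega>\<in>space M. e \<le> dist (Z n \<omega>) l}) \<longlonglongrightarrow> 0"
    by (rule tendsto_sandwich[OF _ bound tendsto_const lim]) auto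
qed (rule Z)

text \<open>Replaces sequences with values in different spaces by real ones, so that
  \<open>tendsto_prob_compose2\<close> can put a pair of them into a single family indexed by
  \<open>bool\<close>.\<close>

lemma tendsto_prob_dist:
  assumes "tendsto_prob M X a"
  shows "tendsto_prob M (\<lambda>n \<omega>. dist (X n \<omega>) a) 0"
  using tendsto_prob_measurable[OF assms] assms by (simp add: tendsto_prob_def)

lemma tendsto_prob_compose2:
  assumes X: "tendsto_prob M X a" and Y: "tendsto_prob M Y b"
    and Z: "\<And>n. Z n \<in> borel_measurable M"
    and ev: "\<And>e. e > 0 \<Longrightarrow> \<exists>d>0. \<forall>\<^sub>F n in sequentially. AE \<omega> in M.
        dist (X n \<omega>) a < d \<longrightarrow> dist (Y n \<omega>) b < d \<longrightarrow> dist (Z n \<omega>) l < e"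
  shows "tendsto_prob M Z l"
proof (rule tendsto_prob_compose_finite[where I = UNIV
      and X = "\<lambda>i. if i then (\<lambda>n \<omega>. dist (X n \<omega>) a) else (\<lambda>n \<omega>. dist (Y n \<omega>) b)"
      and a = "\<lambda>_. 0"])
  show "tendsto_prob M (if i then (\<lambda>n \<omega>. dist (X n \<omega>) a) else (\<lambda>n \<omega>. dist (Y n \<omega>) b)) 0" for i
    using tendsto_prob_dist[OF X] tendsto_prob_dist[OF Y] by simp
  show "\<exists>d>0. \<forall>\<^sub>F n in sequentially. AE \<omega> in M. (\<forall>i\<in>UNIV.
      dist ((if i then (\<lambda>n \<omega>. dist (X n \<omega>) a) else (\<lambda>n \<omega>. dist (Y n \<omega>) b)) n \<omega>) 0 < d) \<longrightarrow>
      dist (Z n \<omega>) l < e" if "e > 0" for e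
    using ev[OF that] unfolding ball_UNIV all_bool_eq by (simp add: imp_conjL[symmetric] conj_commute)
qed (use Z in auto)

text \<open>Continuity at the single point \<open>(a, b)\<close> is what the limit depends on, which
  admits quotients and matrix inversion; measurability of the composed variables is therefore a
  separate premise.\<close>

lemma tendsto_prob_continuous2:
  assumes X: "tendsto_prob M X a" and Y: "tendsto_prob M Y b"
    and f: "isCont (\<lambda>z. f (fst z) (snd z)) (a, b)"
    and Z: "\<And>n. (\<lambda>\<omega>. f (X n \<omega>) (Y n \<omega>)) \<in> borel_measurable M"
  shows "tendsto_prob M (\<lambda>n \<omega>. f (X n \<omega>) (Y n \<omega>)) (f a b)"
proof (rule tendsto_prob_compose2[OF X Y Z])
  fix e :: real assume "e > 0"
  with f obtain d where d: "d > 0" "\<And>z. dist z (a, b) < d \<Longrightarrow> dist (f (fst z) (snd z)) (f a b) < e"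
    by (auto simp: continuous_at_eps_delta)
  have "dist (x, y) (a, b) < d" if "dist x a < d / 2" "dist y b < d / 2" for x y
  proof -
    have "dist (x, y) (a, b) \<le> dist x a + dist y b"
      unfolding dist_Pair_Pair by (rule sqrt_sum_squares_le_sum) auto
    with that show ?thesis by linarith
  qed
  with d show "\<exists>d>0. \<forall>\<^sub>F n in sequentially. AE \<omega> in M. dist (X n \<omega>) a < d \<longrightarrow> dist (Y n \<omega>) b < d \<longrightarrow>
      dist (f (X n \<omega>) (Y n \<omega>)) (f a b) < e"
    by (intro exI[of _ "d / 2"] conjI always_eventually[OF allI]) (use d(2)[of "(_, _)"] in force)+
qed

lemma tendsto_prob_cong_AE:
  assumes X: "tendsto_prob M X a" and Z: "\<And>n. Z n \<in> borel_measurable M"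
    and ae: "\<And>n. AE \<omega> in M. Z n \<omega> = X n \<omega>"
  shows "tendsto_prob M Z a"
proof (rule tendsto_prob_compose2[OF X X Z])
  fix e :: real assume "e > 0"
  moreover have "\<forall>\<^sub>F n in sequentially.
      AE \<omega> in M. dist (X n \<omega>) a < e \<longrightarrow> dist (X n \<omega>) a < e \<longrightarrow> dist (Z n \<omega>) a < e"
  proof (rule always_eventually, rule allI)
    fix n show "AE \<omega> in M. dist (X n \<omega>) a < e \<longrightarrow> dist (X n \<omega>) a < e \<longrightarrow> dist (Z n \<omega>) a < e"
      using ae[of n] by eventually_elim auto
  qed
  ultimately show "\<exists>d>0. \<forall>\<^sub>F n in sequentially. AE \<omega> in M. dist (X n \<omega>) a < d \<longrightarrow>
      dist (X n \<omega>) a < d \<longrightarrow> dist (Z n \<omega>) a < e"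
    by (intro exI[of _ e] conjI)
qed

lemma tendsto_prob_const: "tendsto_prob M (\<lambda>n \<omega>. c) c"
  by (auto simp: tendsto_prob_def not_le)

lemma tendsto_prob_add:
  fixes a b :: real
  assumes X: "tendsto_prob M X a" and Y: "tendsto_prob M Y b"
  shows "tendsto_prob M (\<lambda>n \<omega>. X n \<omega> + Y n \<omega>) (a + b)"
  using X[THEN tendsto_prob_measurable] Y[THEN tendsto_prob_measurable]
  by (intro tendsto_prob_continuous2[OF X Y]) (auto intro!: continuous_intros)

lemma tendsto_prob_diff:
  fixes a b :: real
  assumes X: "tendsto_prob M X a" and Y: "tendsto_prob M Y b"
  shows "tendsto_prob M (\<lambda>n \<omega>. X n \<omega> - Y n \<omega>) (a - b)"
  using X[THEN tendsto_prob_measurable] Y[THEN tendsto_prob_measurable]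
  by (intro tendsto_prob_continuous2[OF X Y]) (auto intro!: continuous_intros)

lemma tendsto_prob_mult:
  fixes a b :: real
  assumes X: "tendsto_prob M X a" and Y: "tendsto_prob M Y b"
  shows "tendsto_prob M (\<lambda>n \<omega>. X n \<omega> * Y n \<omega>) (a * b)"
  using X[THEN tendsto_prob_measurable] Y[THEN tendsto_prob_measurable]
  by (intro tendsto_prob_continuous2[OF X Y]) (auto intro!: continuous_intros)

lemma tendsto_prob_divide:
  fixes a b :: real
  assumes X: "tendsto_prob M X a" and Y: "tendsto_prob M Y b" and "b \<noteq> 0"
  shows "tendsto_prob M (\<lambda>n \<omega>. X n \<omega> / Y n \<omega>) (a / b)"
  using X[THEN tendsto_prob_measurable] Y[THEN tendsto_prob_measurable] \<open>b \<noteq> 0\<close>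
  by (intro tendsto_prob_continuous2[OF X Y]) (auto intro!: continuous_intros)

lemma tendsto_prob_sum_zero:
  fixes X :: "'i \<Rightarrow> nat \<Rightarrow> 'a \<Rightarrow> real"
  assumes "finite I" "\<And>i. i \<in> I \<Longrightarrow> tendsto_prob M (X i) 0"
  shows "tendsto_prob M (\<lambda>n \<omega>. \<Sum>i\<in>I. X i n \<omega>) 0"
  using assms(1, 2)
proof (induction I rule: finite_induct)
  case empty
  show ?case by (simp add: tendsto_prob_const)
next
  case (insert i I)
  then show ?case using tendsto_prob_add[of "X i" 0 "\<lambda>n \<omega>. \<Sum>i\<in>I. X i n \<omega>" 0] by simp
qed

lemma tendsto_prob_vec:
  fixes X :: "nat \<Rightarrow> 'a \<Rightarrow> ('b::euclidean_space)^'n"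
  assumes X: "\<And>k. tendsto_prob M (\<lambda>n \<omega>. X n \<omega> $ k) (c $ k)"
    and Z: "\<And>n. X n \<in> borel_measurable M"
  shows "tendsto_prob M X c"
proof (rule tendsto_prob_compose_finite[where I = UNIV and X = "\<lambda>k n \<omega>. X n \<omega> $ k" and a = "\<lambda>k. c $ k"])
  fix e :: real assume e: "e > 0"
  define d where "d = e / CARD('n)"
  have "d > 0" using e by (simp add: d_def)
  moreover have "dist x c < e" if "\<forall>k. dist (x $ k) (c $ k) < d" for x
  proof -
    have "dist x c \<le> (\<Sum>k\<in>UNIV. dist (x $ k) (c $ k))"
      unfolding dist_vec_def by (rule L2_set_le_sum) auto
    also have "\<dots> < (\<Sum>k\<in>(UNIV::'n set). d)"
      using that by (intro sum_strict_mono) auto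
    also have "\<dots> = e" by (simp add: d_def)
    finally show ?thesis .
  qed
  ultimately show "\<exists>d>0. \<forall>\<^sub>F n in sequentially. AE \<omega> in M. (\<forall>k\<in>UNIV. dist (X n \<omega> $ k) (c $ k) < d) \<longrightarrow> dist (X n \<omega>) c < e"
    by (intro exI[of _ d] conjI always_eventually[OF allI]) auto
qed (use X Z in auto)

lemma tendsto_prob_vec_nth:
  fixes X :: "nat \<Rightarrow> 'a \<Rightarrow> real^'n"
  assumes X: "tendsto_prob M X c" and Z: "\<And>n. (\<lambda>\<omega>. X n \<omega> $ k) \<in> borel_measurable M"
  shows "tendsto_prob M (\<lambda>n \<omega>. X n \<omega> $ k) (c $ k)"
proof (rule tendsto_prob_compose2[OF X X Z])
  fix e :: real assume "e > 0"
  moreover have "dist (X n \<omega> $ k) (c $ k) < e" if "dist (X n \<omega>) c < e" for n \<omega>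
    using that dist_vec_nth_le[of "X n \<omega>" k c] by linarith
  ultimately show "\<exists>d>0. \<forall>\<^sub>F n in sequentially. AE \<omega> in M. dist (X n \<omega>) c < d \<longrightarrow>
      dist (X n \<omega>) c < d \<longrightarrow> dist (X n \<omega> $ k) (c $ k) < e"
    by (intro exI[of _ e] conjI always_eventually[OF allI]) auto
qed

text \<open>Bounded in probability times vanishing in probability vanishes. Chebyshev bounds the
  event \<open>K \<le> \<bar>U n\<bar>\<close> by \<open>C / K^2\<close> uniformly in
  \<open>n\<close>; outside it a product of size \<open>e\<close> forces \<open>V n\<close> to have
  size \<open>e / K\<close>. So \<open>K\<close> is fixed first and \<open>n\<close> is taken large
  afterwards.\<close>

lemma tendsto_prob_mult_bounded_moment:
  assumes U[measurable]: "\<And>n. U n \<in> borel_measurable M"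
    and U2: "\<And>n. integrable M (\<lambda>\<omega>. (U n \<omega>)\<^sup>2)" and C: "\<And>n. expectation (\<lambda>\<omega>. (U n \<omega>)\<^sup>2) \<le> C"
    and V: "tendsto_prob M V 0"
  shows "tendsto_prob M (\<lambda>n \<omega>. U n \<omega> * V n \<omega> :: real) 0"
  unfolding tendsto_prob_def
proof (intro conjI allI impI)
  note [measurable] = V[THEN tendsto_prob_measurable]
  show "(\<lambda>\<omega>. U n \<omega> * V n \<omega>) \<in> borel_measurable M" for n by measurable
  fix e :: real assume e: "e > 0"
  let ?P = "\<lambda>n. prob {\<omega>\<in>space M. e \<le> dist (U n \<omega> * V n \<omega>) 0}"
  have bound: "?P n \<le> C / K\<^sup>2 + prob {\<omega>\<in>space M. e / K \<le> dist (V n \<omega>) 0}" if "K > 0" for K n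
  proof -
    let ?A = "{\<omega>\<in>space M. K \<le> \<bar>U n \<omega>\<bar>}" and ?B = "{\<omega>\<in>space M. e / K \<le> dist (V n \<omega>) 0}"
    have "\<bar>U n \<omega> * V n \<omega>\<bar> < e" if "\<bar>U n \<omega>\<bar> < K" "\<bar>V n \<omega>\<bar> < e / K" for \<omega>
    proof -
      have "\<bar>U n \<omega> * V n \<omega>\<bar> < K * (e / K)"
        unfolding abs_mult using that by (intro mult_strict_mono') auto
      then show ?thesis using \<open>K > 0\<close> by simp
    qed
    then have "?P n \<le> prob (?A \<union> ?B)"
      by (intro finite_measure_mono) (force simp: not_le not_less)+
    also have "\<dots> \<le> prob ?A + prob ?B"
      by (rule measure_Un_le) auto
    also have "prob ?A \<le> expectation (\<lambda>\<omega>. (U n \<omega>)\<^sup>2) / K\<^sup>2"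
      by (rule second_moment_method) (use U2 that in auto)
    also have "\<dots> \<le> C / K\<^sup>2"
      by (intro divide_right_mono C) auto
    finally show ?thesis by simp
  qed
  show "?P \<longlonglongrightarrow> 0"
  proof (rule order_tendstoI)
    fix r :: real assume "r > 0"
    have "((\<lambda>K. C / K\<^sup>2) \<longlongrightarrow> 0) at_top" by real_asymp
    then have "\<forall>\<^sub>F K in at_top. C / K\<^sup>2 < r / 2"
      using \<open>r > 0\<close> by (intro order_tendstoD) auto
    then have "\<forall>\<^sub>F K in at_top. C / K\<^sup>2 < r / 2 \<and> 0 < K"
      using eventually_gt_at_top[of 0] by eventually_elim auto
    then obtain K where K: "C / K\<^sup>2 < r / 2" "0 < K"
      using eventually_happens trivial_limit_at_top_linorder by blast
    have "(\<lambda>n. prob {\<omega>\<in>space M. e / K \<le> dist (V n \<omega>) 0}) \<longlonglongrightarrow> 0"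
      using V e K by (simp add: tendsto_prob_def)
    then have "\<forall>\<^sub>F n in sequentially. prob {\<omega>\<in>space M. e / K \<le> dist (V n \<omega>) 0} < r / 2"
      using \<open>r > 0\<close> by (intro order_tendstoD) auto
    then show "\<forall>\<^sub>F n in sequentially. ?P n < r"
    proof eventually_elim
      case (elim n)
      with bound[OF K(2), of n] K(1) show ?case by linarith
    qed
  next
    fix r :: real assume "r < 0"
    then show "\<forall>\<^sub>F n in sequentially. r < ?P n"
      by (intro always_eventually allI) (meson less_le_trans measure_nonneg)
  qed
qed

text \<open>Slutsky's theorem; the perturbation changes the characteristic functions little because
  \<open>cmod (iexp (t * r) - 1) \<le> min 2 \<bar>t * r\<bar>\<close>.\<close>

lemma weak_conv_add_tendsto_prob:
  assumes Z[measurable]: "\<And>n. Z n \<in> borel_measurable M"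
    and R: "tendsto_prob M R 0"
    and \<nu>: "real_distribution \<nu>"
    and lim: "\<And>t. (\<lambda>n. char (distr M borel (Z n)) t) \<longlonglongrightarrow> char \<nu> t"
  shows "weak_conv_m (\<lambda>n. distr M borel (\<lambda>\<omega>. Z n \<omega> + R n \<omega>)) \<nu>"
proof (rule levy_continuity)
  note [measurable] = R[THEN tendsto_prob_measurable]
  fix t :: real
  let ?c = "\<lambda>Z n. char (distr M borel (Z n)) t"
  have iexp_int: "integrable M (\<lambda>\<omega>. iexp (t * f \<omega>))" if "f \<in> borel_measurable M" for f
    using that by (intro integrable_const_bound[where B = 1]) auto
  have bound: "norm (?c (\<lambda>n \<omega>. Z n \<omega> + R n \<omega>) n - ?c Z n)
      \<le> \<bar>t\<bar> * e + 2 * prob {\<omega>\<in>space M. e \<le> dist (R n \<omega>) 0}" if "e > 0" for e n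
  proof -
    let ?B = "{\<omega>\<in>space M. e \<le> dist (R n \<omega>) 0}"
    have int1: "integrable M (\<lambda>\<omega>. iexp (t * (Z n \<omega> + R n \<omega>)))"
      and int2: "integrable M (\<lambda>\<omega>. iexp (t * Z n \<omega>))"
      by (rule iexp_int; measurable)+
    have "?c (\<lambda>n \<omega>. Z n \<omega> + R n \<omega>) n - ?c Z n =
        (CLINT \<omega>|M. iexp (t * (Z n \<omega> + R n \<omega>)) - iexp (t * Z n \<omega>))"
      unfolding Bochner_Integration.integral_diff[OF int1 int2] by (simp add: char_def integral_distr)
    also have "norm \<dots> \<le> (LINT \<omega>|M. norm (iexp (t * (Z n \<omega> + R n \<omega>)) - iexp (t * Z n \<omega>)))"
      by (rule integral_norm_bound)
    also have "\<dots> \<le> (LINT \<omega>|M. \<bar>t\<bar> * e + 2 * indicator ?B \<omega>)"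
    proof (rule integral_mono)
      show "integrable M (\<lambda>\<omega>. norm (iexp (t * (Z n \<omega> + R n \<omega>)) - iexp (t * Z n \<omega>)))"
        by (intro integrable_norm Bochner_Integration.integrable_diff int1 int2)
      show "integrable M (\<lambda>\<omega>. \<bar>t\<bar> * e + 2 * indicator ?B \<omega> :: real)"
        by (simp add: emeasure_eq_measure)
      fix \<omega> assume "\<omega> \<in> space M"
      have eq: "iexp (t * (Z n \<omega> + R n \<omega>)) - iexp (t * Z n \<omega>) = iexp (t * Z n \<omega>) * (iexp (t * R n \<omega>) - 1)"
        by (simp add: algebra_simps exp_add)
      have "norm (iexp (t * R n \<omega>) - 1) \<le> \<bar>t\<bar> * \<bar>R n \<omega>\<bar>"
        using iexp_approx1[of "t * R n \<omega>" 0] by (simp add: abs_mult)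
      moreover have "norm (iexp (t * R n \<omega>) - 1) \<le> 2"
        using norm_triangle_ineq4[of "iexp (t * R n \<omega>)" 1] by simp
      moreover have "\<bar>t\<bar> * \<bar>R n \<omega>\<bar> \<le> \<bar>t\<bar> * e" if "\<bar>R n \<omega>\<bar> \<le> e"
        using that by (intro mult_left_mono) auto
      moreover have "0 \<le> \<bar>t\<bar> * e" using \<open>e > 0\<close> by simp
      ultimately have "norm (iexp (t * R n \<omega>) - 1) \<le> \<bar>t\<bar> * e + 2 * indicator ?B \<omega>"
        using \<open>\<omega> \<in> space M\<close> by (auto simp: indicator_def)
      then show "norm (iexp (t * (Z n \<omega> + R n \<omega>)) - iexp (t * Z n \<omega>)) \<le> \<bar>t\<bar> * e + 2 * indicator ?B \<omega>"
        unfolding eq norm_mult by simp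
    qed
    also have "\<dots> = \<bar>t\<bar> * e + 2 * prob ?B"
      by (simp add: prob_space emeasure_eq_measure)
    finally show ?thesis .
  qed
  have "(\<lambda>n. ?c (\<lambda>n \<omega>. Z n \<omega> + R n \<omega>) n - ?c Z n) \<longlonglongrightarrow> 0"
  proof (rule LIMSEQ_I)
    fix r :: real assume "r > 0"
    \<comment> \<open>The summand 1 covers \<open>t = 0\<close>. The perturbation costs at most
      \<open>r / 2\<close> off the bad event, and twice a probability below \<open>r / 4\<close> on
      it.\<close>
    define e where "e = r / (2 * (\<bar>t\<bar> + 1))"
    have e: "e > 0" "\<bar>t\<bar> * e \<le> r / 2"
      using \<open>r > 0\<close> by (auto simp: e_def field_simps)
    have "(\<lambda>n. prob {\<omega>\<in>space M. e \<le> dist (R n \<omega>) 0}) \<longlonglongrightarrow> 0"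
      using R e by (simp add: tendsto_prob_def)
    then have "\<forall>\<^sub>F n in sequentially. prob {\<omega>\<in>space M. e \<le> dist (R n \<omega>) 0} < r / 4"
      using \<open>r > 0\<close> by (intro order_tendstoD) auto
    then have "\<forall>\<^sub>F n in sequentially. norm (?c (\<lambda>n \<omega>. Z n \<omega> + R n \<omega>) n - ?c Z n - 0) < r"
    proof eventually_elim
      case (elim n)
      with bound[OF e(1), of n] e(2) show ?case by simp
    qed
    then show "\<exists>no. \<forall>n\<ge>no. norm (?c (\<lambda>n \<omega>. Z n \<omega> + R n \<omega>) n - ?c Z n - 0) < r"
      by (simp add: eventually_sequentially)
  qed
  from tendsto_add[OF this lim[of t]]
  show "(\<lambda>n. char (distr M borel (\<lambda>\<omega>. Z n \<omega> + R n \<omega>)) t) \<longlonglongrightarrow> char \<nu> t"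
    by simp
next
  note [measurable] = R[THEN tendsto_prob_measurable]
  show "real_distribution (distr M borel (\<lambda>\<omega>. Z n \<omega> + R n \<omega>))" for n
    by (rule real_distribution_distr) measurable
qed (rule \<nu>)

end

section \<open>Empirical means of i.i.d. samples\<close>

text \<open>\<open>iid_copies\<close> contains the measurability of each \<open>Zs i\<close> through
  \<open>indep_vars\<close>, but of \<open>Z\<close> it mentions the image measure only; that
  measure is the law of \<open>Z\<close> just when \<open>Z\<close> is measurable.\<close>

locale iid_sample = prob_space M for M :: "'a measure" +
  fixes N :: "'b measure" and Zs :: "nat \<Rightarrow> 'a \<Rightarrow> 'b" and Z :: "'a \<Rightarrow> 'b"
  assumes iid: "iid_copies M N Zs Z" and Z_measurable[measurable]: "Z \<in> M \<rightarrow>\<^sub>M N"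
begin

lemma sample_measurable[measurable]: "Zs i \<in> M \<rightarrow>\<^sub>M N"
  using iid by (auto simp: iid_copies_def indep_vars_def2)

lemma distr_sample: "distr M N (Zs i) = distr M N Z"
  using iid by (simp add: iid_copies_def)

lemma integrable_sample_iff:
  fixes h :: "'b \<Rightarrow> 'c::{banach, second_countable_topology}"
  assumes "h \<in> borel_measurable N"
  shows "integrable M (\<lambda>\<omega>. h (Zs i \<omega>)) \<longleftrightarrow> integrable M (\<lambda>\<omega>. h (Z \<omega>))"
  using integrable_distr_eq[OF sample_measurable assms, of i] integrable_distr_eq[OF Z_measurable assms]
  by (simp add: distr_sample)

lemma expectation_sample:
  fixes h :: "'b \<Rightarrow> 'c::{banach, second_countable_topology}"
  assumes "h \<in> borel_measurable N"
  shows "expectation (\<lambda>\<omega>. h (Zs i \<omega>)) = expectation (\<lambda>\<omega>. h (Z \<omega>))"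
  using integral_distr[OF sample_measurable assms, of i] integral_distr[OF Z_measurable assms]
  by (simp add: distr_sample)

text \<open>An almost sure property that is a measurable condition on the value depends on the law
  alone.\<close>

lemma AE_sample:
  assumes [measurable]: "Measurable.pred N P" and "AE \<omega> in M. P (Z \<omega>)"
  shows "AE \<omega> in M. P (Zs i \<omega>)"
proof -
  have "AE z in distr M N (Zs i). P z"
    unfolding distr_sample using assms by (subst AE_distr_iff) auto
  then show ?thesis by (subst (asm) AE_distr_iff) auto
qed

lemma indep_vars_sample:
  assumes "h \<in> borel_measurable N"
  shows "indep_vars (\<lambda>_. borel) (\<lambda>i \<omega>. h (Zs i \<omega>)) UNIV"
  by (rule indep_vars_compose2[where M' = "\<lambda>_. N"]) (use iid assms in \<open>auto simp: iid_copies_def\<close>)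

text \<open>By induction on \<open>n\<close>: the new summand is independent of the earlier sum and
  both have mean zero, so the cross term of the square integrates to 0.\<close>

lemma
  fixes h :: "'b \<Rightarrow> real"
  assumes h[measurable]: "h \<in> borel_measurable N"
    and sq: "integrable M (\<lambda>\<omega>. (h (Z \<omega>))\<^sup>2)" and mean: "expectation (\<lambda>\<omega>. h (Z \<omega>)) = 0"
  shows integrable_sum_square: "integrable M (\<lambda>\<omega>. (\<Sum>i<n. h (Zs i \<omega>))\<^sup>2)"
    and expectation_sum_square:
      "expectation (\<lambda>\<omega>. (\<Sum>i<n. h (Zs i \<omega>))\<^sup>2) = real n * expectation (\<lambda>\<omega>. (h (Z \<omega>))\<^sup>2)"
proof -
  have "integrable M (\<lambda>\<omega>. h (Z \<omega>))"
    by (rule square_integrable_imp_integrable[OF _ sq]) measurable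
  then have int: "integrable M (\<lambda>\<omega>. h (Zs i \<omega>))" for i
    by (simp add: integrable_sample_iff)
  have sq': "integrable M (\<lambda>\<omega>. (h (Zs i \<omega>))\<^sup>2)" for i
    using sq integrable_sample_iff[of "\<lambda>z. (h z)\<^sup>2" i] by simp
  have mean': "expectation (\<lambda>\<omega>. h (Zs i \<omega>)) = 0" for i
    using mean by (simp add: expectation_sample)
  have "integrable M (\<lambda>\<omega>. (\<Sum>i<n. h (Zs i \<omega>))\<^sup>2) \<and>
    expectation (\<lambda>\<omega>. (\<Sum>i<n. h (Zs i \<omega>))\<^sup>2) = real n * expectation (\<lambda>\<omega>. (h (Z \<omega>))\<^sup>2)"
  proof (induction n)
    case (Suc n)
    let ?S = "\<lambda>\<omega>. \<Sum>i<n. h (Zs i \<omega>)"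
    have "indep_vars (\<lambda>_. borel) (\<lambda>i \<omega>. h (Zs i \<omega>)) (insert n {..<n})"
      by (rule indep_vars_subset[OF indep_vars_sample[OF h]]) auto
    from indep_vars_sum[OF _ _ this]
    have indep: "indep_var borel (\<lambda>\<omega>. h (Zs n \<omega>)) borel ?S" by simp
    have intS: "integrable M ?S" using int by simp
    have cross: "integrable M (\<lambda>\<omega>. h (Zs n \<omega>) * ?S \<omega>)"
      "expectation (\<lambda>\<omega>. h (Zs n \<omega>) * ?S \<omega>) = 0"
      using indep_var_integrable[OF indep int intS] indep_var_lebesgue_integral[OF indep int intS] mean'
      by simp_all
    have eq: "(\<lambda>\<omega>. (\<Sum>i<Suc n. h (Zs i \<omega>))\<^sup>2) =
        (\<lambda>\<omega>. (?S \<omega>)\<^sup>2 + 2 * (h (Zs n \<omega>) * ?S \<omega>) + (h (Zs n \<omega>))\<^sup>2)"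
      by (auto simp: power2_eq_square algebra_simps)
    show ?case
      unfolding eq using Suc cross sq'[of n] expectation_sample[of "\<lambda>z. (h z)\<^sup>2" n]
      by (simp add: algebra_simps)
  qed simp
  then show "integrable M (\<lambda>\<omega>. (\<Sum>i<n. h (Zs i \<omega>))\<^sup>2)"
    "expectation (\<lambda>\<omega>. (\<Sum>i<n. h (Zs i \<omega>))\<^sup>2) = real n * expectation (\<lambda>\<omega>. (h (Z \<omega>))\<^sup>2)"
    by auto
qed

definition emp_mean :: "('b \<Rightarrow> real) \<Rightarrow> nat \<Rightarrow> 'a \<Rightarrow> real" where
  "emp_mean h n \<omega> = (\<Sum>i<n. h (Zs i \<omega>)) / real n"

lemma emp_mean_measurable[measurable]:
  assumes [measurable]: "h \<in> borel_measurable N"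
  shows "emp_mean h n \<in> borel_measurable M"
  unfolding emp_mean_def[abs_def] by measurable

lemma emp_mean_add: "emp_mean (\<lambda>z. f z + g z) n \<omega> = emp_mean f n \<omega> + emp_mean g n \<omega>"
  by (simp add: emp_mean_def sum.distrib add_divide_distrib)

lemma emp_mean_diff: "emp_mean (\<lambda>z. f z - g z) n \<omega> = emp_mean f n \<omega> - emp_mean g n \<omega>"
  by (simp add: emp_mean_def sum_subtractf diff_divide_distrib)

lemma emp_mean_cmult: "emp_mean (\<lambda>z. c * f z) n \<omega> = c * emp_mean f n \<omega>"
  by (simp add: emp_mean_def sum_distrib_left)

text \<open>Supplies the bound, uniform in \<open>n\<close>, that
  \<open>tendsto_prob_mult_bounded_moment\<close> asks for. It is an equality for
  \<open>n > 0\<close>; at \<open>n = 0\<close> the left side is 0.\<close>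

lemma
  fixes h :: "'b \<Rightarrow> real"
  assumes h[measurable]: "h \<in> borel_measurable N"
    and sq: "integrable M (\<lambda>\<omega>. (h (Z \<omega>))\<^sup>2)" and mean: "expectation (\<lambda>\<omega>. h (Z \<omega>)) = 0"
  shows integrable_sqrt_emp_mean: "integrable M (\<lambda>\<omega>. (sqrt (real n) * emp_mean h n \<omega>)\<^sup>2)"
    and expectation_sqrt_emp_mean:
      "expectation (\<lambda>\<omega>. (sqrt (real n) * emp_mean h n \<omega>)\<^sup>2) \<le> expectation (\<lambda>\<omega>. (h (Z \<omega>))\<^sup>2)"
proof -
  have eq: "(sqrt (real n) * emp_mean h n \<omega>)\<^sup>2 = (\<Sum>i<n. h (Zs i \<omega>))\<^sup>2 / real n" for \<omega>
    by (cases "n = 0") (simp_all add: emp_mean_def power_mult_distrib power_divide, simp add: power2_eq_square)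
  show "integrable M (\<lambda>\<omega>. (sqrt (real n) * emp_mean h n \<omega>)\<^sup>2)"
    unfolding eq using integrable_sum_square[OF assms] by simp
  show "expectation (\<lambda>\<omega>. (sqrt (real n) * emp_mean h n \<omega>)\<^sup>2) \<le> expectation (\<lambda>\<omega>. (h (Z \<omega>))\<^sup>2)"
    unfolding eq using expectation_sum_square[OF assms] by (cases "n = 0") simp_all
qed

text \<open>The weak law is proved by truncation: a bounded function has empirical means of
  variance \<open>O(1/n)\<close>, and the contribution of the remainder is small in \<open>L\<^sup>1\<close> uniformly in \<open>n\<close>.\<close>

lemma weak_law_bounded:
  assumes h[measurable]: "h \<in> borel_measurable N" and bdd: "\<And>z. \<bar>h z\<bar> \<le> K"
  shows "tendsto_prob M (emp_mean h) (expectation (\<lambda>\<omega>. h (Z \<omega>)))"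
proof -
  define m where "m = expectation (\<lambda>\<omega>. h (Z \<omega>))"
  let ?g = "\<lambda>z. h z - m"
  have int: "integrable M (\<lambda>\<omega>. h (Z \<omega>))"
    by (rule integrable_const_bound[where B = K]) (use bdd in auto)
  have K: "0 \<le> K" using bdd[of undefined] by linarith
  have m: "\<bar>m\<bar> \<le> K"
  proof -
    have "\<bar>m\<bar> \<le> expectation (\<lambda>\<omega>. \<bar>h (Z \<omega>)\<bar>)" unfolding m_def by (rule integral_abs_bound)
    also have "\<dots> \<le> expectation (\<lambda>_. K)" by (intro integral_mono integrable_abs int bdd) auto
    finally show ?thesis by (simp add: prob_space)
  qed
  have sq: "integrable M (\<lambda>\<omega>. (?g (Z \<omega>))\<^sup>2)"
  proof (rule integrable_const_bound[where B = "(2 * K)\<^sup>2"])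
    have "\<bar>h z - m\<bar> \<le> 2 * K" for z using bdd[of z] m by linarith
    then have "(h z - m)\<^sup>2 \<le> (2 * K)\<^sup>2" for z by (rule abs_le_square_iff[THEN iffD1, OF order_trans]) (use K in simp)
    then show "AE \<omega> in M. norm ((h (Z \<omega>) - m)\<^sup>2) \<le> (2 * K)\<^sup>2" by simp
  qed measurable
  have mean: "expectation (\<lambda>\<omega>. ?g (Z \<omega>)) = 0"
    using int by (simp add: m_def prob_space)
  have "tendsto_prob M (\<lambda>n \<omega>. emp_mean ?g n \<omega>) 0"
  proof -
    \<comment> \<open>The centred mean is \<open>sqrt n\<close> times itself, which has bounded
      second moment, times this deterministic null sequence.\<close>
    have "tendsto_prob M (\<lambda>n \<omega>. 1 / sqrt (real n)) 0"
      unfolding tendsto_prob_def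
    proof (intro conjI allI impI)
      fix e :: real assume "e > 0"
      have "(\<lambda>n. 1 / sqrt (real n)) \<longlonglongrightarrow> 0" by real_asymp
      then have "\<forall>\<^sub>F n in sequentially. 1 / sqrt (real n) < e"
        using \<open>e > 0\<close> by (rule order_tendstoD)
      then have "\<forall>\<^sub>F n in sequentially. prob {\<omega> \<in> space M. e \<le> dist (1 / sqrt (real n)) 0} = 0"
        by eventually_elim simp
      then show "(\<lambda>n. prob {\<omega> \<in> space M. e \<le> dist (1 / sqrt (real n)) 0}) \<longlonglongrightarrow> 0"
        by (rule tendsto_eventually)
    qed measurable
    then have "tendsto_prob M (\<lambda>n \<omega>. sqrt (real n) * emp_mean ?g n \<omega> * (1 / sqrt (real n))) 0"
      by (rule tendsto_prob_mult_bounded_moment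
            [OF _ integrable_sqrt_emp_mean[OF _ sq mean] expectation_sqrt_emp_mean[OF _ sq mean], rotated 3])
         measurable
    moreover have "sqrt (real n) * emp_mean ?g n \<omega> * (1 / sqrt (real n)) = emp_mean ?g n \<omega>" for n \<omega>
      by (cases "n = 0") (simp_all add: emp_mean_def)
    ultimately show ?thesis by (simp only:)
  qed
  then have T: "tendsto_prob M (\<lambda>n \<omega>. emp_mean ?g n \<omega> + m) m"
    using tendsto_prob_add[OF _ tendsto_prob_const[of m], of "emp_mean ?g" 0] by simp
  show ?thesis
    unfolding m_def[symmetric]
  proof (rule tendsto_prob_compose2[OF T T])
    fix e :: real assume "e > 0"
    \<comment> \<open>At \<open>n = 0\<close> the mean of \<open>h\<close> is 0 while the shifted
      mean of \<open>?g\<close> is \<open>m\<close>, so the two agree for positive \<open>n\<close>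
      only.\<close>
    have eq: "dist (emp_mean h n \<omega>) m = dist (emp_mean ?g n \<omega> + m) m" if "n > 0" for n \<omega>
      using that by (simp add: emp_mean_def dist_real_def sum_subtractf diff_divide_distrib)
    have "\<forall>\<^sub>F n in sequentially. AE \<omega> in M. dist (emp_mean ?g n \<omega> + m) m < e \<longrightarrow>
        dist (emp_mean ?g n \<omega> + m) m < e \<longrightarrow> dist (emp_mean h n \<omega>) m < e"
      by (rule eventually_mono[OF eventually_gt_at_top[of 0]]) (simp add: eq)
    with \<open>e > 0\<close> show "\<exists>d>0. \<forall>\<^sub>F n in sequentially. AE \<omega> in M. dist (emp_mean ?g n \<omega> + m) m < d \<longrightarrow>
        dist (emp_mean ?g n \<omega> + m) m < d \<longrightarrow> dist (emp_mean h n \<omega>) m < e"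
      by (intro exI[of _ e] conjI)
  qed measurable
qed

theorem weak_law_of_large_numbers:
  assumes h[measurable]: "h \<in> borel_measurable N" and int: "integrable M (\<lambda>\<omega>. h (Z \<omega>))"
  shows "tendsto_prob M (emp_mean h) (expectation (\<lambda>\<omega>. h (Z \<omega>)))"
  unfolding tendsto_prob_def
proof (intro conjI allI impI)
  fix e :: real assume e: "e > 0"
  define m where "m = expectation (\<lambda>\<omega>. h (Z \<omega>))"
  define t where "t K z = (if \<bar>h z\<bar> \<le> K then h z else 0)" for K z
  define \<delta> where "\<delta> K = expectation (\<lambda>\<omega>. \<bar>h (Z \<omega>) - t K (Z \<omega>)\<bar>)" for K
  have [measurable]: "t K \<in> borel_measurable N" for K
    unfolding t_def[abs_def] by measurable
  have t_bdd: "\<bar>t K z\<bar> \<le> \<bar>K\<bar>" for K z by (simp add: t_def)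
  have t_int: "integrable M (\<lambda>\<omega>. t K (Z \<omega>))" for K
    by (rule integrable_const_bound[where B = "\<bar>K\<bar>"]) (use t_bdd in auto)
  have "((\<lambda>K. \<delta> (real K)) \<longlongrightarrow> expectation (\<lambda>\<omega>. 0)) sequentially"
    unfolding \<delta>_def
  proof (rule integral_dominated_convergence[where w = "\<lambda>\<omega>. \<bar>h (Z \<omega>)\<bar>"])
    show "AE \<omega> in M. (\<lambda>K. \<bar>h (Z \<omega>) - t (real K) (Z \<omega>)\<bar>) \<longlonglongrightarrow> 0"
    proof (intro AE_I2 tendsto_eventually)
      fix \<omega>
      obtain K0 :: nat where "\<bar>h (Z \<omega>)\<bar> \<le> real K0" using real_arch_simple by blast
      then show "\<forall>\<^sub>F K in sequentially. \<bar>h (Z \<omega>) - t (real K) (Z \<omega>)\<bar> = 0"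
        by (intro eventually_sequentiallyI[of K0]) (auto simp: t_def)
    qed
    show "AE \<omega> in M. norm \<bar>h (Z \<omega>) - t (real K) (Z \<omega>)\<bar> \<le> \<bar>h (Z \<omega>)\<bar>" for K
      by (auto simp: t_def)
  qed (use int in auto)
  then have \<delta>_lim: "(\<lambda>K. \<delta> (real K)) \<longlonglongrightarrow> 0" by simp
  let ?P = "\<lambda>n. prob {\<omega>\<in>space M. e \<le> dist (emp_mean h n \<omega>) m}"
  \<comment> \<open>A deviation \<open>e\<close> is split as follows: the bias of truncation takes
    less than \<open>e / 4\<close>, so either the truncated mean deviates by \<open>e / 2\<close> or
    the mean of the cut-off part reaches \<open>e / 4\<close>. Markov bounds the latter event by a
    quantity free of \<open>n\<close>.\<close>
  have bound: "?P n \<le> prob {\<omega>\<in>space M. e / 2 \<le> dist (emp_mean (t K) n \<omega>) (expectation (\<lambda>\<omega>. t K (Z \<omega>)))}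
      + \<delta> K / (e / 4)" if "\<delta> K < e / 4" for K n
  proof -
    let ?r = "\<lambda>z. h z - t K z"
    let ?R = "emp_mean (\<lambda>z. \<bar>?r z\<bar>) n"
    let ?A = "{\<omega>\<in>space M. e / 2 \<le> dist (emp_mean (t K) n \<omega>) (expectation (\<lambda>\<omega>. t K (Z \<omega>)))}"
    let ?B = "{\<omega>\<in>space M. e / 4 \<le> ?R \<omega>}"
    have int_r: "integrable M (\<lambda>\<omega>. \<bar>?r (Zs i \<omega>)\<bar>)" for i
      using int t_int by (subst integrable_sample_iff[of "\<lambda>z. \<bar>?r z\<bar>"]) auto
    have "\<bar>expectation (\<lambda>\<omega>. ?r (Z \<omega>))\<bar> \<le> \<delta> K"
      unfolding \<delta>_def by (rule integral_abs_bound)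
    then have bias: "\<bar>m - expectation (\<lambda>\<omega>. t K (Z \<omega>))\<bar> < e / 4"
      using that int t_int by (simp add: m_def)
    have approx: "\<bar>emp_mean h n \<omega> - emp_mean (t K) n \<omega>\<bar> \<le> ?R \<omega>" for \<omega>
      unfolding emp_mean_diff[symmetric] by (simp add: emp_mean_def sum_abs divide_right_mono)
    have "\<omega> \<in> ?A \<union> ?B" if "\<omega> \<in> space M" "e \<le> dist (emp_mean h n \<omega>) m" for \<omega>
    proof -
      have "e / 2 \<le> \<bar>emp_mean (t K) n \<omega> - expectation (\<lambda>\<omega>. t K (Z \<omega>))\<bar> \<or> e / 4 \<le> ?R \<omega>"
        using approx[of \<omega>] bias that(2) unfolding dist_real_def by linarith
      then show ?thesis using that(1) by (auto simp: dist_real_def)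
    qed
    then have "?P n \<le> prob (?A \<union> ?B)"
      by (intro finite_measure_mono) auto
    also have "\<dots> \<le> prob ?A + prob ?B" by (rule measure_Un_le) auto
    also have "prob ?B \<le> expectation ?R / (e / 4)"
      by (rule integral_Markov_inequality_measure[where A = "{}"])
         (use int_r e in \<open>auto simp: emp_mean_def sum_nonneg\<close>)
    also have "expectation ?R \<le> \<delta> K"
      using int_r expectation_sample[of "\<lambda>z. \<bar>?r z\<bar>"]
      by (cases "n = 0") (simp_all add: emp_mean_def[abs_def] \<delta>_def)
    finally show ?thesis using e by (simp add: divide_right_mono)
  qed
  show "?P \<longlonglongrightarrow> 0"
  proof (rule order_tendstoI)
    fix r :: real assume "r > 0"
    \<comment> \<open>Below \<open>e / 4\<close> the truncation level is admissible in
      \<open>bound\<close>; below \<open>r / 2 * (e / 4)\<close> its Markov term is less than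
      \<open>r / 2\<close>.\<close>
    then have "\<forall>\<^sub>F K in sequentially. \<delta> (real K) < min (e / 4) (r / 2 * (e / 4))"
      using e by (intro order_tendstoD[OF \<delta>_lim]) auto
    from eventually_happens'[OF sequentially_bot this]
    obtain K :: nat where K: "\<delta> (real K) < e / 4" "\<delta> (real K) < r / 2 * (e / 4)"
      by auto
    then have \<delta>K: "\<delta> (real K) / (e / 4) < r / 2" using e by (subst pos_divide_less_eq) auto
    have "tendsto_prob M (emp_mean (t K)) (expectation (\<lambda>\<omega>. t K (Z \<omega>)))"
      by (rule weak_law_bounded[OF _ t_bdd]) measurable
    then have "(\<lambda>n. prob {\<omega>\<in>space M. e / 2 \<le>
        dist (emp_mean (t K) n \<omega>) (expectation (\<lambda>\<omega>. t K (Z \<omega>)))}) \<longlonglongrightarrow> 0"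
      unfolding tendsto_prob_def using e half_gt_zero by blast
    then have "\<forall>\<^sub>F n in sequentially. prob {\<omega>\<in>space M. e / 2 \<le>
        dist (emp_mean (t K) n \<omega>) (expectation (\<lambda>\<omega>. t K (Z \<omega>)))} < r / 2"
      by (rule order_tendstoD) (use \<open>r > 0\<close> in simp)
    then show "\<forall>\<^sub>F n in sequentially. ?P n < r"
    proof eventually_elim
      case (elim n)
      with bound[OF K(1), of n] \<delta>K show ?case by linarith
    qed
  next
    fix r :: real assume "r < 0"
    then show "\<forall>\<^sub>F n in sequentially. r < ?P n"
      by (intro always_eventually allI) (meson less_le_trans measure_nonneg)
  qed
qed measurable

section \<open>The central limit theorem for empirical means, degenerate variance included\<close>

lemma real_distribution_centered_normal: "real_distribution (centered_normal V)"
  unfolding centered_normal_def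
  by (rule prob_space.real_distribution_distr) (auto simp: prob_space_normal_density)

lemma char_centered_normal: "char (centered_normal V) t = exp (- (sqrt V * t)\<^sup>2 / 2)"
proof -
  have "char (centered_normal V) t = char std_normal_distribution (sqrt V * t)"
    unfolding centered_normal_def char_def by (subst integral_distr) (simp_all add: ac_simps)
  then show ?thesis by (simp add: char_std_normal_distribution)
qed

text \<open>The classical theorem normalises by the standard deviation, so \<open>V = 0\<close> is
  separate: there the means vanish almost surely and the limit is the point mass at 0. With
  characteristic functions, undoing the normalisation is evaluation at \<open>sqrt V * t\<close>,
  and the result has the form in which \<open>weak_conv_add_tendsto_prob\<close> takes its
  hypothesis.\<close>

theorem char_sqrt_emp_mean_tendsto:
  assumes h[measurable]: "h \<in> borel_measurable N"
    and sq: "integrable M (\<lambda>\<omega>. (h (Z \<omega>))\<^sup>2)" and mean: "expectation (\<lambda>\<omega>. h (Z \<omega>)) = 0"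
  defines "V \<equiv> expectation (\<lambda>\<omega>. (h (Z \<omega>))\<^sup>2)"
  shows "(\<lambda>n. char (distr M borel (\<lambda>\<omega>. sqrt (real n) * emp_mean h n \<omega>)) t) \<longlonglongrightarrow> char (centered_normal V) t"
proof (cases "V = 0")
  case True
  then have "AE \<omega> in M. (h (Z \<omega>))\<^sup>2 = 0"
    using sq unfolding V_def by (subst (asm) integral_nonneg_eq_0_iff_AE) auto
  then have "AE \<omega> in M. h (Z \<omega>) = 0" by simp
  then have "AE \<omega> in M. h (Zs i \<omega>) = 0" for i
    by (intro AE_sample) auto
  then have "AE \<omega> in M. \<forall>i. h (Zs i \<omega>) = 0" by (simp add: AE_all_countable)
  then have "AE \<omega> in M. sqrt (real n) * emp_mean h n \<omega> = 0" for n
    by eventually_elim (simp add: emp_mean_def)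
  then have "distr M borel (\<lambda>\<omega>. sqrt (real n) * emp_mean h n \<omega>) = distr M borel (\<lambda>\<omega>. 0)" for n
    by (intro distr_cong_AE) auto
  then have "char (distr M borel (\<lambda>\<omega>. sqrt (real n) * emp_mean h n \<omega>)) t = 1" for n
    by (simp add: char_def integral_distr prob_space del: distr_const)
  then show ?thesis by (simp add: char_centered_normal True)
next
  case False
  then have V: "V > 0" unfolding V_def by (simp add: less_le)
  let ?S = "\<lambda>n \<omega>. (\<Sum>i<n. h (Zs i \<omega>)) / sqrt (real n * (sqrt V)\<^sup>2)"
  have "weak_conv_m (\<lambda>n. distr M borel (?S n)) std_normal_distribution"
  proof (rule central_limit_theorem_zero_mean[where \<mu> = "distr M borel (\<lambda>\<omega>. h (Z \<omega>))"])
    show "indep_vars (\<lambda>_. borel) (\<lambda>i \<omega>. h (Zs i \<omega>)) UNIV" by (rule indep_vars_sample[OF h])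
    show mean': "expectation (\<lambda>\<omega>. h (Zs i \<omega>)) = 0" for i using mean by (simp add: expectation_sample)
    show "0 < sqrt V" using V by simp
    show "integrable M (\<lambda>\<omega>. (h (Zs i \<omega>))\<^sup>2)" for i
      using sq integrable_sample_iff[of "\<lambda>z. (h z)\<^sup>2" i] by simp
    show "variance (\<lambda>\<omega>. h (Zs i \<omega>)) = (sqrt V)\<^sup>2" for i
      using V expectation_sample[of "\<lambda>z. (h z)\<^sup>2" i] by (simp add: mean' V_def)
    show "distr M borel (\<lambda>\<omega>. h (Zs i \<omega>)) = distr M borel (\<lambda>\<omega>. h (Z \<omega>))" for i
      using distr_distr[OF h sample_measurable, of i] distr_distr[OF h Z_measurable]
      by (simp add: distr_sample comp_def)
  qed
  then have lim: "(\<lambda>n. char (distr M borel (?S n)) (sqrt V * t)) \<longlonglongrightarrow>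
      char std_normal_distribution (sqrt V * t)"
    by (intro levy_continuity1 real_distribution_distr real_dist_normal_dist) auto
  have scale: "sqrt V * ?S n \<omega> = sqrt (real n) * emp_mean h n \<omega>" for n \<omega>
    using V by (cases "n = 0") (simp_all add: emp_mean_def real_sqrt_mult field_simps)
  have "char (distr M borel (?S n)) (sqrt V * t) =
      char (distr M borel (\<lambda>\<omega>. sqrt (real n) * emp_mean h n \<omega>)) t" for n
    unfolding scale[symmetric] char_def by (simp add: integral_distr ac_simps)
  with lim show ?thesis
    by (simp add: char_centered_normal char_std_normal_distribution)
qed

end

section \<open>Solving a random linear system\<close>

lemma tendsto_det:
  fixes A :: "'b \<Rightarrow> real^'n^'n"
  assumes "(A \<longlongrightarrow> L) F"
  shows "((\<lambda>x. det (A x)) \<longlongrightarrow> det L) F"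
  unfolding det_def by (intro tendsto_intros assms)

lemma borel_measurable_det:
  fixes A :: "'b \<Rightarrow> real^'n^'n"
  assumes "A \<in> borel_measurable M"
  shows "(\<lambda>\<omega>. det (A \<omega>)) \<in> borel_measurable M"
proof -
  have "continuous_on UNIV (det :: real^'n^'n \<Rightarrow> real)"
    unfolding continuous_on_def by (intro ballI tendsto_det tendsto_ident_at)
  from borel_measurable_continuous_on[OF this assms] show ?thesis .
qed

lemma borel_measurable_vec_componentwise:
  fixes f :: "'b \<Rightarrow> ('c::euclidean_space)^'n"
  assumes "\<And>k. (\<lambda>\<omega>. f \<omega> $ k) \<in> borel_measurable M"
  shows "f \<in> borel_measurable M"
proof (rule borel_measurable_euclidean_space[THEN iffD2], rule ballI)
  fix i :: "'c^'n" assume "i \<in> Basis"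
  then obtain k u where i: "i = axis k u" "u \<in> Basis" by (auto simp: Basis_vec_def)
  have "(\<lambda>\<omega>. f \<omega> \<bullet> i) = (\<lambda>\<omega>. f \<omega> $ k \<bullet> u)"
    by (simp add: i inner_axis)
  then show "(\<lambda>\<omega>. f \<omega> \<bullet> i) \<in> borel_measurable M"
    using assms[of k] by simp
qed

lemma borel_measurable_vec_nth[measurable (raw)]:
  fixes f :: "'b \<Rightarrow> ('c::euclidean_space)^'n"
  assumes "f \<in> borel_measurable M"
  shows "(\<lambda>\<omega>. f \<omega> $ k) \<in> borel_measurable M"
  by (rule borel_measurable_continuous_on[OF _ assms]) (intro continuous_intros)

lemma matrix_inv_right:
  fixes A :: "real^'n^'n"
  assumes "det A \<noteq> 0"
  shows "A ** matrix_inv A = mat 1"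
proof -
  have "\<exists>A'. A ** A' = mat 1 \<and> A' ** A = mat 1"
    using assms by (simp add: invertible_det_nz[symmetric] invertible_def)
  then show ?thesis unfolding matrix_inv_def by (rule someI2_ex) simp
qed

text \<open>Presents the solution as a quotient of polynomials in the entries of \<open>A\<close>
  and \<open>b\<close>; both its continuity and its measurability are read off from this
  form.\<close>

lemma matrix_inv_mult_cramer:
  fixes A :: "real^'n^'n"
  assumes "det A \<noteq> 0"
  shows "matrix_inv A *v b = (\<chi> k. det (\<chi> i j. if j = k then b $ i else A $ i $ j) / det A)"
  by (subst cramer[OF assms, symmetric])
     (simp add: matrix_vector_mul_assoc matrix_inv_right[OF assms])

text \<open>Nonsingularity is an open condition, so near \<open>(A, b)\<close> the map coincides
  with the quotient of determinants.\<close>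

lemma isCont_matrix_inv_mult:
  fixes A :: "real^'n^'n"
  assumes "det A \<noteq> 0"
  shows "isCont (\<lambda>z. matrix_inv (fst z) *v snd z) (A, b)"
proof -
  have "((\<lambda>z :: (real^'n^'n) \<times> (real^'n). det (fst z)) \<longlongrightarrow> det A) (nhds (A, b))"
    by (rule tendsto_det) (auto intro!: tendsto_eq_intros filterlim_ident)
  then have "\<forall>\<^sub>F z in nhds (A, b). det (fst z) \<noteq> 0"
    using assms by (rule tendsto_imp_eventually_ne)
  then have "\<forall>\<^sub>F z in nhds (A, b). matrix_inv (fst z) *v snd z =
      (\<chi> k. det (\<chi> i j. if j = k then snd z $ i else fst z $ i $ j) / det (fst z))"
    by eventually_elim (rule matrix_inv_mult_cramer)
  then show ?thesis
  proof (rule isCont_cong[THEN iffD2])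
    have "((\<lambda>z. if j = k then snd z $ i else fst z $ i $ j) \<longlongrightarrow>
        (if j = k then snd (A, b) $ i else fst (A, b) $ i $ j)) (at (A, b))" for i j k :: 'n
      by (cases "j = k") (auto intro!: tendsto_eq_intros)
    then show "isCont (\<lambda>z. \<chi> k. det (\<chi> i j. if j = k then snd z $ i else fst z $ i $ j) / det (fst z)) (A, b)"
      unfolding isCont_def using assms
      by (intro tendsto_vec_lambda tendsto_divide tendsto_det tendsto_fst tendsto_ident_at) auto
  qed
qed

text \<open>\<open>has_asymptotic_variance\<close> requires the estimator to be measurable for every
  \<open>n\<close>, on the event that \<open>A_hat\<close> is singular as well. There the map is
  \<open>b\<close> multiplied by a constant matrix; elsewhere it is given by determinants.\<close>

lemma borel_measurable_matrix_inv_mult: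
  fixes A :: "'b \<Rightarrow> real^'n^'n"
  assumes A[measurable]: "A \<in> borel_measurable M" and b[measurable]: "b \<in> borel_measurable M"
  shows "(\<lambda>\<omega>. matrix_inv (A \<omega>) *v b \<omega>) \<in> borel_measurable M"
proof -
  \<comment> \<open>Singular matrices all have the same totalised inverse.\<close>
  define S :: "real^'n^'n" where "S = (SOME A'. False)"
  have singular: "matrix_inv A = S" if "det A = 0" for A :: "real^'n^'n"
  proof -
    have "\<not> (A ** A' = mat 1 \<and> A' ** A = mat 1)" for A'
      using that invertible_det_nz[of A] by (auto simp: invertible_def)
    then have "(\<lambda>A'. A ** A' = mat 1 \<and> A' ** A = mat 1) = (\<lambda>A'. False)"
      by (intro ext) blast
    then show ?thesis unfolding matrix_inv_def S_def by (rule arg_cong)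
  qed
  note [measurable] = borel_measurable_det[OF A]
  have "(\<lambda>\<omega>. det (\<chi> i j. if j = k then b \<omega> $ i else A \<omega> $ i $ j)) \<in> borel_measurable M" for k
  proof (intro borel_measurable_det borel_measurable_vec_componentwise)
    fix i j show "(\<lambda>\<omega>. (\<chi> i j. if j = k then b \<omega> $ i else A \<omega> $ i $ j) $ i $ j) \<in> borel_measurable M"
      by (cases "j = k") simp_all
  qed
  then have "(\<lambda>\<omega>. if det (A \<omega>) = 0 then S *v b \<omega>
      else (\<chi> k. det (\<chi> i j. if j = k then b \<omega> $ i else A \<omega> $ i $ j) / det (A \<omega>))) \<in> borel_measurable M"
    by (intro measurable_If borel_measurable_vec_componentwise)
       (simp_all add: matrix_vector_mult_def)
  then show ?thesis
    by (rule measurable_cong[THEN iffD2, rotated]) (auto simp: singular matrix_inv_mult_cramer)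
qed

section \<open>Propensity weighting\<close>

context prob_space
begin

lemma sigma_finite_subalgebra_vimage:
  fixes X :: "'a \<Rightarrow> real^'k"
  assumes "X \<in> borel_measurable M"
  shows "sigma_finite_subalgebra M (vimage_algebra (space M) X borel)"
proof (rule finite_measure_subalgebra_is_sigma_finite, unfold_locales)
  show "subalgebra M (vimage_algebra (space M) X borel)"
    using assms by (auto simp: subalgebra_def sets_vimage_algebra2 dest: measurable_sets)
qed

lemma
  fixes X :: "'a \<Rightarrow> real^'k" and Y :: "'a \<Rightarrow> real"
  assumes X[measurable]: "X \<in> borel_measurable M" and Y[measurable]: "Y \<in> borel_measurable M"
    and f[measurable]: "f \<in> borel_measurable borel"
    and int: "integrable M (\<lambda>\<omega>. f (X \<omega>) * Y \<omega>)"
  shows integrable_mult_cexp: "integrable M (\<lambda>\<omega>. f (X \<omega>) * cexp M X Y \<omega>)"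
    and integral_mult_cexp: "expectation (\<lambda>\<omega>. f (X \<omega>) * cexp M X Y \<omega>) = expectation (\<lambda>\<omega>. f (X \<omega>) * Y \<omega>)"
proof -
  interpret sigma_finite_subalgebra M "vimage_algebra (space M) X borel"
    by (rule sigma_finite_subalgebra_vimage[OF X])
  have fX: "(\<lambda>\<omega>. f (X \<omega>)) \<in> borel_measurable (vimage_algebra (space M) X borel)"
    by (rule measurable_compose[OF measurable_vimage_algebra1 f]) auto
  show "integrable M (\<lambda>\<omega>. f (X \<omega>) * cexp M X Y \<omega>)"
    "expectation (\<lambda>\<omega>. f (X \<omega>) * cexp M X Y \<omega>) = expectation (\<lambda>\<omega>. f (X \<omega>) * Y \<omega>)"
    using real_cond_exp_intg[OF int fX Y] by auto
qed

text \<open>By unconfoundedness, the two weightings of \<open>M\<close> agree on measurable rectangles.\<close>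

lemma cond_indep_distr_eq:
  fixes X :: "'a \<Rightarrow> real^'k" and Y :: "'a \<Rightarrow> 'u::second_countable_topology"
    and D :: "'a \<Rightarrow> 'v::topological_space"
  assumes X[measurable]: "X \<in> borel_measurable M" and Y[measurable]: "Y \<in> borel_measurable M"
    and D[measurable]: "D \<in> borel_measurable M"
    and indep: "cond_indep M X Y D" and B[measurable]: "B \<in> sets borel"
    and q[measurable]: "q \<in> borel_measurable borel"
    and q01: "AE \<omega> in M. 0 \<le> q (X \<omega>) \<and> q (X \<omega>) \<le> 1"
    and propensity: "AE \<omega> in M. q (X \<omega>) = cprob M X {\<omega>\<in>space M. D \<omega> \<in> B} \<omega>"
  shows "distr (density M (\<lambda>\<omega>. ennreal (indicator B (D \<omega>)))) (borel \<Otimes>\<^sub>M borel) (\<lambda>\<omega>. (X \<omega>, Y \<omega>)) =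
    distr (density M (\<lambda>\<omega>. ennreal (q (X \<omega>)))) (borel \<Otimes>\<^sub>M borel) (\<lambda>\<omega>. (X \<omega>, Y \<omega>))"
    (is "?L = ?R")
proof (rule measure_eqI_generator_eq[OF Int_stable_pair_measure_generator[of borel borel],
      where \<Omega> = UNIV and A = "\<lambda>_. UNIV \<times> UNIV"])
  fix S :: "((real^'k) \<times> 'u) set" assume "S \<in> {a \<times> b |a b. a \<in> sets borel \<and> b \<in> sets borel}"
  then obtain A C where S: "S = A \<times> C" and [measurable]: "A \<in> sets borel" "C \<in> sets borel" by auto
  let ?f = "indicator A :: real^'k \<Rightarrow> real"
  let ?Y = "\<lambda>\<omega>. indicator {\<omega>\<in>space M. Y \<omega> \<in> C} \<omega> :: real"
  let ?DY = "\<lambda>\<omega>. indicator {\<omega>\<in>space M. Y \<omega> \<in> C \<and> D \<omega> \<in> B} \<omega> :: real"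
  have bddY: "AE \<omega> in M. norm (?f (X \<omega>) * q (X \<omega>) * ?Y \<omega>) \<le> 1"
    using q01 by eventually_elim (auto simp: indicator_def)
  have intY: "integrable M (\<lambda>\<omega>. ?f (X \<omega>) * q (X \<omega>) * ?Y \<omega>)"
    by (rule integrable_const_bound[OF bddY]) measurable
  have intDY: "integrable M (\<lambda>\<omega>. ?f (X \<omega>) * ?DY \<omega>)"
    by (rule integrable_const_bound[where B = 1]) (auto simp: indicator_def)
  have "expectation (\<lambda>\<omega>. ?f (X \<omega>) * ?DY \<omega>) = expectation (\<lambda>\<omega>. ?f (X \<omega>) * cexp M X ?DY \<omega>)"
    by (rule integral_mult_cexp[symmetric]) (use intDY in auto)
  \<comment> \<open>The sole use of unconfoundedness: given \<open>X\<close>, the indicator of the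
    joint event has as conditional expectation that of \<open>?Y\<close> times the conditional
    probability of the treatment event, which is \<open>q (X)\<close>.\<close>
  also have "\<dots> = expectation (\<lambda>\<omega>. ?f (X \<omega>) * q (X \<omega>) * cexp M X ?Y \<omega>)"
  proof (rule integral_cong_AE)
    have "AE \<omega> in M. cexp M X ?DY \<omega> = cexp M X ?Y \<omega> * cprob M X {\<omega>\<in>space M. D \<omega> \<in> B} \<omega>"
      using indep unfolding cond_indep_def cprob_def by auto
    then show "AE \<omega> in M. ?f (X \<omega>) * cexp M X ?DY \<omega> = ?f (X \<omega>) * q (X \<omega>) * cexp M X ?Y \<omega>"
      using propensity by eventually_elim simp
  qed measurable
  also have "\<dots> = expectation (\<lambda>\<omega>. ?f (X \<omega>) * q (X \<omega>) * ?Y \<omega>)"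
    by (rule integral_mult_cexp[of _ _ "\<lambda>x. ?f x * q x"]) (use intY in auto)
  finally have eq: "expectation (\<lambda>\<omega>. ?f (X \<omega>) * ?DY \<omega>) = expectation (\<lambda>\<omega>. ?f (X \<omega>) * q (X \<omega>) * ?Y \<omega>)" .
  have "emeasure ?L S = (\<integral>\<^sup>+\<omega>. ennreal (?f (X \<omega>) * ?DY \<omega>) \<partial>M)"
    unfolding S by (subst emeasure_distr, simp, simp, subst emeasure_density)
      (auto intro!: nn_integral_cong simp: indicator_def)
  also have "\<dots> = ennreal (expectation (\<lambda>\<omega>. ?f (X \<omega>) * ?DY \<omega>))"
    by (rule nn_integral_eq_integral[OF intDY]) simp
  also have "\<dots> = ennreal (expectation (\<lambda>\<omega>. ?f (X \<omega>) * q (X \<omega>) * ?Y \<omega>))" by (simp only: eq)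
  also have "\<dots> = (\<integral>\<^sup>+\<omega>. ennreal (?f (X \<omega>) * q (X \<omega>) * ?Y \<omega>) \<partial>M)"
    by (rule nn_integral_eq_integral[OF intY, symmetric]) (use q01 in eventually_elim, simp)
  also have "\<dots> = emeasure ?R S"
    unfolding S by (subst emeasure_distr, simp, simp, subst emeasure_density)
      (auto intro!: nn_integral_cong simp: indicator_def)
  finally show "emeasure ?L S = emeasure ?R S" .
next
  have UN: "(UNIV :: ((real^'k) \<times> 'u) set) \<in> sets (borel \<Otimes>\<^sub>M borel)"
    using sets.top[of "borel \<Otimes>\<^sub>M borel :: ((real^'k) \<times> 'u) measure"] by (simp add: space_pair_measure)
  \<comment> \<open>Uniqueness of a measure on an intersection-stable generator needs generator sets
    of finite mass that exhaust the space; here the whole space is one.\<close>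
  have "emeasure ?L UNIV = (\<integral>\<^sup>+\<omega>. ennreal (indicator B (D \<omega>)) * indicator (space M) \<omega> \<partial>M)"
    by (subst emeasure_distr[OF _ UN], simp, subst emeasure_density) auto
  also have "\<dots> \<le> (\<integral>\<^sup>+\<omega>. 1 \<partial>M)"
    by (rule nn_integral_mono) (auto split: split_indicator)
  finally have "emeasure ?L UNIV \<le> 1" by (simp add: emeasure_space_1)
  then show "emeasure ?L (UNIV \<times> UNIV) \<noteq> \<infinity>" for i :: nat
    by (auto simp: top_unique)
  show "range (\<lambda>_ :: nat. UNIV \<times> UNIV :: ((real^'k) \<times> 'u) set) \<subseteq> {a \<times> b |a b. a \<in> sets borel \<and> b \<in> sets borel}"
    by (rule image_subsetI, rule CollectI, intro exI[of _ UNIV] conjI refl) auto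
qed (auto simp: sets_pair_measure)

text \<open>Integrate \<open>g / q\<close> against the common image measure of
  \<open>cond_indep_distr_eq\<close>: one density turns it into the weighted integrand, while the
  other cancels \<open>q\<close>. Equality of measures transfers integrability in both directions
  along with the integral.\<close>

lemma
  fixes X :: "'a \<Rightarrow> real^'k" and Y :: "'a \<Rightarrow> 'u::second_countable_topology"
    and D :: "'a \<Rightarrow> 'v::topological_space" and g :: "(real^'k) \<times> 'u \<Rightarrow> real"
  assumes X[measurable]: "X \<in> borel_measurable M" and Y[measurable]: "Y \<in> borel_measurable M"
    and D[measurable]: "D \<in> borel_measurable M"
    and indep: "cond_indep M X Y D" and B[measurable]: "B \<in> sets borel"
    and q[measurable]: "q \<in> borel_measurable borel"
    and q01: "AE \<omega> in M. 0 < q (X \<omega>) \<and> q (X \<omega>) < 1"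
    and propensity: "AE \<omega> in M. q (X \<omega>) = cprob M X {\<omega>\<in>space M. D \<omega> \<in> B} \<omega>"
    and g: "g \<in> borel_measurable borel"
  shows integrable_propensity_weighting:
      "integrable M (\<lambda>\<omega>. indicator B (D \<omega>) / q (X \<omega>) * g (X \<omega>, Y \<omega>)) \<longleftrightarrow> integrable M (\<lambda>\<omega>. g (X \<omega>, Y \<omega>))"
    and integral_propensity_weighting:
      "expectation (\<lambda>\<omega>. indicator B (D \<omega>) / q (X \<omega>) * g (X \<omega>, Y \<omega>)) = expectation (\<lambda>\<omega>. g (X \<omega>, Y \<omega>))"
proof -
  have [measurable]: "g \<in> borel_measurable (borel \<Otimes>\<^sub>M borel)"
    using g by (simp add: borel_prod)
  let ?g = "\<lambda>z. g z / q (fst z)" and ?Z = "\<lambda>\<omega>. (X \<omega>, Y \<omega>)"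
  let ?L = "distr (density M (\<lambda>\<omega>. ennreal (indicator B (D \<omega>)))) (borel \<Otimes>\<^sub>M borel) ?Z"
  let ?R = "distr (density M (\<lambda>\<omega>. ennreal (q (X \<omega>)))) (borel \<Otimes>\<^sub>M borel) ?Z"
  have q0: "AE \<omega> in M. 0 \<le> q (X \<omega>)" using q01 by eventually_elim simp
  have LR: "?L = ?R"
    by (rule cond_indep_distr_eq[OF X Y D indep B q _ propensity]) (use q01 in eventually_elim, simp)
  have cong: "AE \<omega> in M. q (X \<omega>) * ?g (?Z \<omega>) = g (?Z \<omega>)"
    using q01 by eventually_elim simp
  have "integrable ?L ?g \<longleftrightarrow> integrable M (\<lambda>\<omega>. indicator B (D \<omega>) * ?g (?Z \<omega>))"
    by (subst integrable_distr_eq, simp, simp, subst integrable_density) auto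
  moreover have "integrable ?R ?g \<longleftrightarrow> integrable M (\<lambda>\<omega>. q (X \<omega>) * ?g (?Z \<omega>))"
    using q0 by (subst integrable_distr_eq, simp, simp, subst integrable_density) auto
  moreover have "\<dots> \<longleftrightarrow> integrable M (\<lambda>\<omega>. g (?Z \<omega>))"
    by (rule integrable_cong_AE[OF _ _ cong]) measurable
  ultimately show "integrable M (\<lambda>\<omega>. indicator B (D \<omega>) / q (X \<omega>) * g (X \<omega>, Y \<omega>)) \<longleftrightarrow>
      integrable M (\<lambda>\<omega>. g (X \<omega>, Y \<omega>))"
    using LR by simp
  have "integral\<^sup>L ?L ?g = expectation (\<lambda>\<omega>. indicator B (D \<omega>) * ?g (?Z \<omega>))"
    by (subst integral_distr, simp, simp, subst integral_density) auto
  moreover have "integral\<^sup>L ?R ?g = expectation (\<lambda>\<omega>. q (X \<omega>) * ?g (?Z \<omega>))"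
    using q0 by (subst integral_distr, simp, simp, subst integral_density) auto
  moreover have "\<dots> = expectation (\<lambda>\<omega>. g (?Z \<omega>))"
    by (rule integral_cong_AE[OF _ _ cong]) measurable
  ultimately show "expectation (\<lambda>\<omega>. indicator B (D \<omega>) / q (X \<omega>) * g (X \<omega>, Y \<omega>)) =
      expectation (\<lambda>\<omega>. g (X \<omega>, Y \<omega>))"
    using LR by simp
qed

end

section \<open>One treatment arm\<close>

lemma borel_measurable_fst[measurable (raw)]:
  fixes f :: "'b \<Rightarrow> 'c::second_countable_topology \<times> 'd::second_countable_topology"
  assumes "f \<in> borel_measurable M"
  shows "(\<lambda>\<omega>. fst (f \<omega>)) \<in> borel_measurable M"
  using measurable_compose[OF assms[unfolded borel_prod[symmetric]] measurable_fst] .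

lemma borel_measurable_snd[measurable (raw)]:
  fixes f :: "'b \<Rightarrow> 'c::second_countable_topology \<times> 'd::second_countable_topology"
  assumes "f \<in> borel_measurable M"
  shows "(\<lambda>\<omega>. snd (f \<omega>)) \<in> borel_measurable M"
  using measurable_compose[OF assms[unfolded borel_prod[symmetric]] measurable_snd] .

lemma abs_le_quadratic: "\<bar>s\<bar> \<le> 1 * (1 + s\<^sup>2 + t\<^sup>2)" for s t :: real
proof -
  have "0 \<le> (\<bar>s\<bar> - 1)\<^sup>2" and t: "0 \<le> t\<^sup>2" by simp_all
  then have "\<bar>s\<bar> * 2 \<le> 1 + s\<^sup>2" by (simp add: power2_diff)
  then show ?thesis using t abs_ge_zero[of s] unfolding mult_1_left by linarith
qed

lemma abs_mult_le_quadratic: "\<bar>s * t\<bar> \<le> s\<^sup>2 + t\<^sup>2" for s t :: real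
proof -
  have "0 \<le> (\<bar>s\<bar> - \<bar>t\<bar>)\<^sup>2" by simp
  then have "2 * \<bar>s * t\<bar> \<le> s\<^sup>2 + t\<^sup>2" by (simp add: power2_diff abs_mult)
  then show ?thesis using abs_ge_zero[of "s * t"] by linarith
qed

lemma vec_nth_square_le: "(x $ k)\<^sup>2 \<le> (norm x)\<^sup>2" for x :: "real^'n"
  using component_le_norm_cart[of x k] by (simp add: abs_le_square_iff[symmetric])

text \<open>One majorant for all monomials in covariates and outcome that the estimator averages.
  The literal factors \<open>1 *\<close> and \<open>2 *\<close> give each bound the shape
  \<open>K * (...)\<close> of the premise \<open>bound\<close> in
  \<open>integrable_divide\<close>.\<close>

lemma monomial_bounds:
  fixes x :: "real^'n" and t :: real
  shows "\<bar>1\<bar> \<le> 1 * (1 + (norm x)\<^sup>2 + t\<^sup>2)"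
    and "\<bar>x $ k\<bar> \<le> 1 * (1 + (norm x)\<^sup>2 + t\<^sup>2)"
    and "\<bar>t\<bar> \<le> 1 * (1 + (norm x)\<^sup>2 + t\<^sup>2)"
    and "\<bar>t * x $ k\<bar> \<le> 1 * (1 + (norm x)\<^sup>2 + t\<^sup>2)"
    and "\<bar>x $ k * x $ j\<bar> \<le> 2 * (1 + (norm x)\<^sup>2 + t\<^sup>2)"
proof -
  define N T where "N = (norm x)\<^sup>2" and "T = t\<^sup>2"
  have "0 \<le> N" "0 \<le> T" by (simp_all add: N_def T_def)
  moreover have "\<bar>x $ k\<bar> \<le> 1 * (1 + (x $ k)\<^sup>2 + T)" "\<bar>t\<bar> \<le> 1 * (1 + T + N)"
    unfolding N_def T_def by (rule abs_le_quadratic)+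
  moreover have "\<bar>t * x $ k\<bar> \<le> T + (x $ k)\<^sup>2" "\<bar>x $ k * x $ j\<bar> \<le> (x $ k)\<^sup>2 + (x $ j)\<^sup>2"
    unfolding T_def by (rule abs_mult_le_quadratic)+
  moreover have "(x $ k)\<^sup>2 \<le> N" "(x $ j)\<^sup>2 \<le> N"
    unfolding N_def by (rule vec_nth_square_le)+
  ultimately have "\<bar>1\<bar> \<le> 1 * (1 + N + T)" "\<bar>x $ k\<bar> \<le> 1 * (1 + N + T)" "\<bar>t\<bar> \<le> 1 * (1 + N + T)"
    "\<bar>t * x $ k\<bar> \<le> 1 * (1 + N + T)" "\<bar>x $ k * x $ j\<bar> \<le> 2 * (1 + N + T)"
    unfolding mult_1_left distrib_left by simp_all
  then show "\<bar>1\<bar> \<le> 1 * (1 + (norm x)\<^sup>2 + t\<^sup>2)"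
    "\<bar>x $ k\<bar> \<le> 1 * (1 + (norm x)\<^sup>2 + t\<^sup>2)"
    "\<bar>t\<bar> \<le> 1 * (1 + (norm x)\<^sup>2 + t\<^sup>2)"
    "\<bar>t * x $ k\<bar> \<le> 1 * (1 + (norm x)\<^sup>2 + t\<^sup>2)"
    "\<bar>x $ k * x $ j\<bar> \<le> 2 * (1 + (norm x)\<^sup>2 + t\<^sup>2)"
    by (simp_all add: N_def T_def)
qed

text \<open>Both treatment arms have the same structure: \<open>w\<close> is the indicator of the arm and \<open>q\<close> its
  propensity score, that is \<open>D\<close> and \<open>p\<close> or \<open>1 - D\<close> and \<open>1 - p\<close>, and \<open>y\<close> is the potential
  outcome, whose regression on the covariates is \<open>\<alpha> + c \<bullet> X\<close>.\<close>

locale treatment_arm = iid_sample M borel Zs Z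
  for M :: "'a measure" and Zs :: "nat \<Rightarrow> 'a \<Rightarrow> (real^'k) \<times> 'u::second_countable_topology"
    and Z :: "'a \<Rightarrow> (real^'k) \<times> 'u" +
  fixes q :: "real^'k \<Rightarrow> real" and w y :: "(real^'k) \<times> 'u \<Rightarrow> real" and \<alpha> :: real and c :: "real^'k"
  assumes q_measurable[measurable]: "q \<in> borel_measurable borel"
    and w_measurable[measurable]: "w \<in> borel_measurable borel"
    and y_measurable[measurable]: "y \<in> borel_measurable borel"
    and w01: "AE \<omega> in M. w (Z \<omega>) \<in> {0, 1}"
    and q01: "AE \<omega> in M. 0 < q (fst (Z \<omega>)) \<and> q (fst (Z \<omega>)) < 1"
    and integrable_dominating:
      "integrable M (\<lambda>\<omega>. (1 + (norm (fst (Z \<omega>)))\<^sup>2 + (y (Z \<omega>))\<^sup>2) / q (fst (Z \<omega>)))"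
    and integrable_weighting: "\<And>g. g \<in> borel_measurable borel \<Longrightarrow>
      integrable M (\<lambda>\<omega>. w (Z \<omega>) / q (fst (Z \<omega>)) * g (fst (Z \<omega>), y (Z \<omega>))) \<longleftrightarrow>
      integrable M (\<lambda>\<omega>. g (fst (Z \<omega>), y (Z \<omega>)) :: real)"
    and integral_weighting: "\<And>g. g \<in> borel_measurable borel \<Longrightarrow>
      expectation (\<lambda>\<omega>. w (Z \<omega>) / q (fst (Z \<omega>)) * g (fst (Z \<omega>), y (Z \<omega>))) =
      expectation (\<lambda>\<omega>. g (fst (Z \<omega>), y (Z \<omega>)))"
    and regression: "\<And>f. f \<in> borel_measurable borel \<Longrightarrow>
      integrable M (\<lambda>\<omega>. f (fst (Z \<omega>)) * y (Z \<omega>)) \<Longrightarrow>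
      expectation (\<lambda>\<omega>. f (fst (Z \<omega>)) * y (Z \<omega>)) =
      expectation (\<lambda>\<omega>. f (fst (Z \<omega>)) * (\<alpha> + c \<bullet> fst (Z \<omega>)))"
begin

definition ipw_weight :: "(real^'k) \<times> 'u \<Rightarrow> real" where
  "ipw_weight z = w z / q (fst z)"

definition residual :: "(real^'k) \<times> 'u \<Rightarrow> real" where
  "residual z = y z - (\<alpha> + c \<bullet> fst z)"

text \<open>The body mentions only \<open>M\<close> and \<open>Z\<close>, so the two arms of
  \<open>two_arms\<close> have this vector in common.\<close>

definition \<mu> :: "real^'k" where
  "\<mu> = expectation (\<lambda>\<omega>. fst (Z \<omega>))"

lemma ipw_weight_measurable[measurable]: "ipw_weight \<in> borel_measurable borel"
  unfolding ipw_weight_def[abs_def] by measurable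

lemma residual_measurable[measurable]: "residual \<in> borel_measurable borel"
  unfolding residual_def[abs_def] by measurable

text \<open>The quotient is dominated by hypothesis, and as \<open>0 < q < 1\<close> the quotient in
  turn dominates \<open>g\<close> itself.\<close>

lemma
  assumes [measurable]: "g \<in> borel_measurable borel"
    and bound: "\<And>z. \<bar>g z\<bar> \<le> K * (1 + (norm (fst z))\<^sup>2 + (y z)\<^sup>2)"
  shows integrable_divide: "integrable M (\<lambda>\<omega>. g (Z \<omega>) / q (fst (Z \<omega>)))"
    and integrable_undivided: "integrable M (\<lambda>\<omega>. g (Z \<omega>))"
proof -
  let ?H = "\<lambda>z. 1 + (norm (fst z))\<^sup>2 + (y z)\<^sup>2"
  have int: "integrable M (\<lambda>\<omega>. K * (?H (Z \<omega>) / q (fst (Z \<omega>))))"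
    by (rule integrable_mult_right[OF integrable_dominating])
  have "AE \<omega> in M. norm (g (Z \<omega>) / q (fst (Z \<omega>))) \<le> norm (K * (?H (Z \<omega>) / q (fst (Z \<omega>))))"
    using q01
  proof eventually_elim
    case (elim \<omega>)
    have "\<bar>g (Z \<omega>)\<bar> / q (fst (Z \<omega>)) \<le> K * ?H (Z \<omega>) / q (fst (Z \<omega>))"
      using elim by (intro divide_right_mono bound) auto
    then show ?case using elim abs_ge_self[of "K * ?H (Z \<omega>) / q (fst (Z \<omega>))"] by simp
  qed
  then show divide: "integrable M (\<lambda>\<omega>. g (Z \<omega>) / q (fst (Z \<omega>)))"
    by (rule Bochner_Integration.integrable_bound[OF int, rotated]) measurable
  have "AE \<omega> in M. norm (g (Z \<omega>)) \<le> norm (g (Z \<omega>) / q (fst (Z \<omega>)))"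
    using q01
  proof eventually_elim
    case (elim \<omega>)
    then have "q (fst (Z \<omega>)) * \<bar>g (Z \<omega>)\<bar> \<le> 1 * \<bar>g (Z \<omega>)\<bar>" by (intro mult_right_mono) auto
    then show ?case using elim by (simp add: pos_le_divide_eq mult.commute)
  qed
  then show "integrable M (\<lambda>\<omega>. g (Z \<omega>))"
    by (rule Bochner_Integration.integrable_bound[OF divide, rotated]) measurable
qed

lemmas bounded_monomials = monomial_bounds[where x = "fst z" and t = "y z" for z]

lemma integrable_monomials:
  shows "integrable M (\<lambda>\<omega>. fst (Z \<omega>) $ k)"
    and "integrable M (\<lambda>\<omega>. y (Z \<omega>))"
    and "integrable M (\<lambda>\<omega>. 1 / q (fst (Z \<omega>)))"
    and "integrable M (\<lambda>\<omega>. fst (Z \<omega>) $ k / q (fst (Z \<omega>)))"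
    and "integrable M (\<lambda>\<omega>. y (Z \<omega>) / q (fst (Z \<omega>)))"
    and "integrable M (\<lambda>\<omega>. y (Z \<omega>) * fst (Z \<omega>) $ k / q (fst (Z \<omega>)))"
    and "integrable M (\<lambda>\<omega>. fst (Z \<omega>) $ k * fst (Z \<omega>) $ j / q (fst (Z \<omega>)))"
proof -
  show "integrable M (\<lambda>\<omega>. fst (Z \<omega>) $ k)"
    by (rule integrable_undivided[OF _ bounded_monomials(2)]) measurable
  show "integrable M (\<lambda>\<omega>. y (Z \<omega>))"
    by (rule integrable_undivided[OF _ bounded_monomials(3)]) measurable
  show "integrable M (\<lambda>\<omega>. 1 / q (fst (Z \<omega>)))"
    by (rule integrable_divide[OF _ bounded_monomials(1)]) measurable
  show "integrable M (\<lambda>\<omega>. fst (Z \<omega>) $ k / q (fst (Z \<omega>)))"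
    by (rule integrable_divide[OF _ bounded_monomials(2)]) measurable
  show "integrable M (\<lambda>\<omega>. y (Z \<omega>) / q (fst (Z \<omega>)))"
    by (rule integrable_divide[OF _ bounded_monomials(3)]) measurable
  show "integrable M (\<lambda>\<omega>. y (Z \<omega>) * fst (Z \<omega>) $ k / q (fst (Z \<omega>)))"
    by (rule integrable_divide[OF _ bounded_monomials(4)]) measurable
  show "integrable M (\<lambda>\<omega>. fst (Z \<omega>) $ k * fst (Z \<omega>) $ j / q (fst (Z \<omega>)))"
    by (rule integrable_divide[OF _ bounded_monomials(5)]) measurable
qed

lemma integrable_covariates: "integrable M (\<lambda>\<omega>. fst (Z \<omega>))"
proof -
  have "\<bar>norm (fst z)\<bar> \<le> 1 * (1 + (norm (fst z))\<^sup>2 + (y z)\<^sup>2)" for z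
    by (rule abs_le_quadratic)
  then have "integrable M (\<lambda>\<omega>. norm (fst (Z \<omega>)))"
    by (rule integrable_undivided[rotated]) measurable
  then show ?thesis by (subst (asm) integrable_norm_iff) auto
qed

lemma \<mu>_nth: "\<mu> $ k = expectation (\<lambda>\<omega>. fst (Z \<omega>) $ k)"
  unfolding \<mu>_def cart_eq_inner_axis using integrable_covariates by simp

lemma covariate_mean_law: "tendsto_prob M (emp_mean (\<lambda>z. fst z $ k)) (\<mu> $ k)"
  unfolding \<mu>_nth by (rule weak_law_of_large_numbers) (use integrable_monomials(1) in measurable)

lemma expectation_outcome: "expectation (\<lambda>\<omega>. y (Z \<omega>)) = \<alpha> + c \<bullet> \<mu>"
proof -
  have "expectation (\<lambda>\<omega>. y (Z \<omega>)) = expectation (\<lambda>\<omega>. \<alpha> + c \<bullet> fst (Z \<omega>))"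
    using regression[of "\<lambda>_. 1"] integrable_monomials(2) by simp
  also have "\<dots> = \<alpha> + c \<bullet> \<mu>"
    unfolding \<mu>_def using integrable_covariates by (simp add: prob_space)
  finally show ?thesis .
qed

lemma weighted_law:
  assumes [measurable]: "g \<in> borel_measurable borel"
    and "integrable M (\<lambda>\<omega>. g (fst (Z \<omega>), y (Z \<omega>)))"
  shows "tendsto_prob M (emp_mean (\<lambda>z. ipw_weight z * g (fst z, y z)))
    (expectation (\<lambda>\<omega>. g (fst (Z \<omega>), y (Z \<omega>))))"
proof -
  have [measurable]: "(\<lambda>z. (fst z, y z)) \<in> borel_measurable borel" 
    by measurable
  have "(\<lambda>z. ipw_weight z * g (fst z, y z)) \<in> borel_measurable borel" by measurable
  from weak_law_of_large_numbers[OF this] show ?thesis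
    using integrable_weighting[OF assms(1)] integral_weighting[OF assms(1)] assms(2)
    by (simp add: ipw_weight_def)
qed

text \<open>The origin of the \<open>1 / q\<close> in the variance: almost surely \<open>w\<close>
  equals its square, so the squared weight is \<open>w / q\<close> times \<open>1 / q\<close>. The
  weighting identity absorbs the first factor and leaves the second.\<close>

lemma
  assumes g[measurable]: "g \<in> borel_measurable borel"
    and int: "integrable M (\<lambda>\<omega>. (g (fst (Z \<omega>), y (Z \<omega>)))\<^sup>2 / q (fst (Z \<omega>)))"
  shows integrable_weighted_square:
      "integrable M (\<lambda>\<omega>. (ipw_weight (Z \<omega>) * g (fst (Z \<omega>), y (Z \<omega>)))\<^sup>2)"
    and expectation_weighted_square:
      "expectation (\<lambda>\<omega>. (ipw_weight (Z \<omega>) * g (fst (Z \<omega>), y (Z \<omega>)))\<^sup>2) =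
        expectation (\<lambda>\<omega>. (g (fst (Z \<omega>), y (Z \<omega>)))\<^sup>2 / q (fst (Z \<omega>)))"
proof -
  let ?g2 = "\<lambda>x. (g x)\<^sup>2 / q (fst x)"
  have [measurable]: "?g2 \<in> borel_measurable borel" by measurable
  have eq: "AE \<omega> in M. (ipw_weight (Z \<omega>) * g (fst (Z \<omega>), y (Z \<omega>)))\<^sup>2 =
      w (Z \<omega>) / q (fst (Z \<omega>)) * ?g2 (fst (Z \<omega>), y (Z \<omega>))"
    using w01 by eventually_elim (auto simp: ipw_weight_def power2_eq_square)
  have "integrable M (\<lambda>\<omega>. (ipw_weight (Z \<omega>) * g (fst (Z \<omega>), y (Z \<omega>)))\<^sup>2) \<longleftrightarrow>
      integrable M (\<lambda>\<omega>. w (Z \<omega>) / q (fst (Z \<omega>)) * ?g2 (fst (Z \<omega>), y (Z \<omega>)))"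
    by (rule integrable_cong_AE[OF _ _ eq]) measurable
  also have "\<dots> \<longleftrightarrow> integrable M (\<lambda>\<omega>. ?g2 (fst (Z \<omega>), y (Z \<omega>)))"
    by (rule integrable_weighting) measurable
  finally show "integrable M (\<lambda>\<omega>. (ipw_weight (Z \<omega>) * g (fst (Z \<omega>), y (Z \<omega>)))\<^sup>2)"
    using int by simp
  have "expectation (\<lambda>\<omega>. (ipw_weight (Z \<omega>) * g (fst (Z \<omega>), y (Z \<omega>)))\<^sup>2) =
      expectation (\<lambda>\<omega>. w (Z \<omega>) / q (fst (Z \<omega>)) * ?g2 (fst (Z \<omega>), y (Z \<omega>)))"
    by (rule integral_cong_AE[OF _ _ eq]) measurable
  also have "\<dots> = expectation (\<lambda>\<omega>. ?g2 (fst (Z \<omega>), y (Z \<omega>)))"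
    by (rule integral_weighting) measurable
  finally show "expectation (\<lambda>\<omega>. (ipw_weight (Z \<omega>) * g (fst (Z \<omega>), y (Z \<omega>)))\<^sup>2) =
      expectation (\<lambda>\<omega>. (g (fst (Z \<omega>), y (Z \<omega>)))\<^sup>2 / q (fst (Z \<omega>)))" by simp
qed

lemma weight_law: "tendsto_prob M (emp_mean ipw_weight) 1"
proof -
  have "tendsto_prob M (emp_mean (\<lambda>z. ipw_weight z * 1)) (expectation (\<lambda>\<omega>. 1))"
    by (rule weighted_law[where g = "\<lambda>_. 1"]) simp_all
  moreover have "expectation (\<lambda>\<omega>. 1) = (1 :: real)"
    by (simp add: prob_space)
  ultimately show ?thesis by (simp only: mult_1_right)
qed

lemma weighted_outcome_law: "tendsto_prob M (emp_mean (\<lambda>z. ipw_weight z * y z)) (\<alpha> + c \<bullet> \<mu>)"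
proof -
  have "(snd :: (real^'k) \<times> real \<Rightarrow> real) \<in> borel_measurable borel" by measurable
  from weighted_law[OF this] show ?thesis
    using integrable_monomials(2) by (simp add: expectation_outcome)
qed

text \<open>These make \<open>sqrt n\<close> times the weighted mean of the centred covariates
  bounded in second moment, as needed for the term with the error of
  \<open>alpha_hat\<close>.\<close>

lemma
  shows integrable_weighted_covariate_square:
      "integrable M (\<lambda>\<omega>. (ipw_weight (Z \<omega>) * (fst (Z \<omega>) $ k - \<mu> $ k))\<^sup>2)"
    and weighted_covariate_mean_zero:
      "expectation (\<lambda>\<omega>. ipw_weight (Z \<omega>) * (fst (Z \<omega>) $ k - \<mu> $ k)) = 0"
proof -
  have meas: "(\<lambda>x :: (real^'k) \<times> real. fst x $ k - \<mu> $ k) \<in> borel_measurable borel" by measurable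
  have "\<bar>(fst z $ k - \<mu> $ k)\<^sup>2\<bar> \<le> (2 + 2 * (\<mu> $ k)\<^sup>2) * (1 + (norm (fst z))\<^sup>2 + (y z)\<^sup>2)" for z
  proof -
    have "(fst z $ k - \<mu> $ k)\<^sup>2 \<le> 2 * (fst z $ k)\<^sup>2 + 2 * (\<mu> $ k)\<^sup>2"
      using zero_le_power2[of "fst z $ k + \<mu> $ k"] by (simp add: power2_sum power2_diff)
    also have "\<dots> \<le> 2 * (norm (fst z))\<^sup>2 + 2 * (\<mu> $ k)\<^sup>2"
      using vec_nth_square_le[of "fst z" k] by simp
    also have "\<dots> \<le> (2 + 2 * (\<mu> $ k)\<^sup>2) * (1 + (norm (fst z))\<^sup>2 + (y z)\<^sup>2)"
      by (simp add: distrib_left distrib_right)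
    finally show ?thesis by simp
  qed
  then have "integrable M (\<lambda>\<omega>. (fst (Z \<omega>) $ k - \<mu> $ k)\<^sup>2 / q (fst (Z \<omega>)))"
    by (rule integrable_divide[rotated]) measurable
  then show "integrable M (\<lambda>\<omega>. (ipw_weight (Z \<omega>) * (fst (Z \<omega>) $ k - \<mu> $ k))\<^sup>2)"
    using integrable_weighted_square[OF meas] by simp
  show "expectation (\<lambda>\<omega>. ipw_weight (Z \<omega>) * (fst (Z \<omega>) $ k - \<mu> $ k)) = 0"
    using integral_weighting[OF meas] integrable_monomials(1)
    by (simp add: ipw_weight_def \<mu>_nth prob_space)
qed

lemma integrable_residual_square: "integrable M (\<lambda>\<omega>. (residual (Z \<omega>))\<^sup>2 / q (fst (Z \<omega>)))"
proof (rule integrable_divide)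
  fix z :: "(real^'k) \<times> 'u"
  \<comment> \<open>The right side minus the left side is
    \<open>(r + s)^2 + (r + t)^2 + (s - t)^2\<close>.\<close>
  have sq3: "(r - (s + t))\<^sup>2 \<le> 3 * r\<^sup>2 + 3 * s\<^sup>2 + 3 * t\<^sup>2" for r s t :: real
    using zero_le_power2[of "r + s"] zero_le_power2[of "r + t"] zero_le_power2[of "s - t"]
    by (simp add: power2_sum power2_diff algebra_simps)
  have "(c \<bullet> fst z)\<^sup>2 \<le> (norm c)\<^sup>2 * (norm (fst z))\<^sup>2"
    using Cauchy_Schwarz_ineq[of c "fst z"] by (simp add: power2_norm_eq_inner)
  then have "(residual z)\<^sup>2 \<le> 3 * (y z)\<^sup>2 + 3 * \<alpha>\<^sup>2 + 3 * ((norm c)\<^sup>2 * (norm (fst z))\<^sup>2)"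
    using sq3[of "y z" \<alpha> "c \<bullet> fst z"] by (simp add: residual_def)
  also have "\<dots> \<le> (3 + 3 * \<alpha>\<^sup>2 + 3 * (norm c)\<^sup>2) * (1 + (norm (fst z))\<^sup>2 + (y z)\<^sup>2)"
    by (simp add: distrib_left distrib_right)
  finally show "\<bar>(residual z)\<^sup>2\<bar> \<le> (3 + 3 * \<alpha>\<^sup>2 + 3 * (norm c)\<^sup>2) * (1 + (norm (fst z))\<^sup>2 + (y z)\<^sup>2)"
    by simp
qed measurable

lemma
  shows integrable_weighted_residual_square:
      "integrable M (\<lambda>\<omega>. (ipw_weight (Z \<omega>) * residual (Z \<omega>))\<^sup>2)"
    and expectation_weighted_residual_square:
      "expectation (\<lambda>\<omega>. (ipw_weight (Z \<omega>) * residual (Z \<omega>))\<^sup>2) =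
        expectation (\<lambda>\<omega>. (residual (Z \<omega>))\<^sup>2 / q (fst (Z \<omega>)))"
    and weighted_residual_mean_zero: "expectation (\<lambda>\<omega>. ipw_weight (Z \<omega>) * residual (Z \<omega>)) = 0"
proof -
  let ?r = "\<lambda>x. snd x - (\<alpha> + c \<bullet> fst x)"
  have meas: "?r \<in> borel_measurable borel" by measurable
  show "integrable M (\<lambda>\<omega>. (ipw_weight (Z \<omega>) * residual (Z \<omega>))\<^sup>2)"
    "expectation (\<lambda>\<omega>. (ipw_weight (Z \<omega>) * residual (Z \<omega>))\<^sup>2) =
        expectation (\<lambda>\<omega>. (residual (Z \<omega>))\<^sup>2 / q (fst (Z \<omega>)))"
    using integrable_weighted_square[OF meas] expectation_weighted_square[OF meas] integrable_residual_square
    by (simp_all add: residual_def)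
  have "expectation (\<lambda>\<omega>. y (Z \<omega>) - (\<alpha> + c \<bullet> fst (Z \<omega>))) = 0"
    using integrable_monomials(2) integrable_covariates expectation_outcome
    by (simp add: prob_space \<mu>_def)
  then show "expectation (\<lambda>\<omega>. ipw_weight (Z \<omega>) * residual (Z \<omega>)) = 0"
    using integral_weighting[OF meas] by (simp add: ipw_weight_def residual_def)
qed

text \<open>The share of this arm in coordinate \<open>k\<close> of \<open>b_hat\<close>, multiplied
  out. The summands of \<open>b_hat\<close> are centred at sample means and so change with
  \<open>n\<close>; here each factor is the empirical mean of a fixed function, to which the weak
  law applies.\<close>

definition b_term :: "'k \<Rightarrow> nat \<Rightarrow> 'a \<Rightarrow> real" where
  "b_term k n \<omega> =
     emp_mean (\<lambda>z. ipw_weight z * (y z * fst z $ k / q (fst z))) n \<omega>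
     - emp_mean (\<lambda>z. ipw_weight z * y z) n \<omega> * emp_mean (\<lambda>z. ipw_weight z * (fst z $ k / q (fst z))) n \<omega>
     - emp_mean (\<lambda>z. fst z $ k) n \<omega> *
       (emp_mean (\<lambda>z. ipw_weight z * (y z / q (fst z))) n \<omega>
        - emp_mean (\<lambda>z. ipw_weight z * y z) n \<omega> * emp_mean (\<lambda>z. ipw_weight z * (1 / q (fst z))) n \<omega>)"

text \<open>Factor by factor, the limit is the mean of
  \<open>(X - \<mu>)_k * (y - (\<alpha> + c \<bullet> \<mu>)) / q\<close>. The cofactor of
  \<open>y\<close> is a function of \<open>X\<close>, so the regression may replace \<open>y\<close>
  by \<open>\<alpha> + c \<bullet> X\<close>, and the intercept cancels.\<close>

lemma b_term_law:
  "tendsto_prob M (b_term k)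
    (expectation (\<lambda>\<omega>. (fst (Z \<omega>) $ k - \<mu> $ k) * (c \<bullet> (fst (Z \<omega>) - \<mu>)) / q (fst (Z \<omega>))))"
proof -
  let ?E = "\<lambda>f. expectation (\<lambda>\<omega>. f (Z \<omega>) / q (fst (Z \<omega>)))"
  let ?f = "\<lambda>x. (x $ k - \<mu> $ k) / q x"
  have law: "tendsto_prob M (emp_mean (\<lambda>z. ipw_weight z * (g (fst z, y z) / q (fst z))))
      (expectation (\<lambda>\<omega>. g (fst (Z \<omega>), y (Z \<omega>)) / q (fst (Z \<omega>))))"
    if [measurable]: "g \<in> borel_measurable borel"
      and int: "integrable M (\<lambda>\<omega>. g (fst (Z \<omega>), y (Z \<omega>)) / q (fst (Z \<omega>)))" for g
  proof -
    have meas: "(\<lambda>x. g x / q (fst x)) \<in> borel_measurable borel" by measurable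
    show ?thesis using weighted_law[OF meas] int by (simp only: fst_conv)
  qed
  have meas: "(\<lambda>x :: (real^'k) \<times> real. snd x * fst x $ k) \<in> borel_measurable borel"
    "(\<lambda>x :: (real^'k) \<times> real. fst x $ k) \<in> borel_measurable borel"
    "(snd :: (real^'k) \<times> real \<Rightarrow> real) \<in> borel_measurable borel"
    "(\<lambda>x :: (real^'k) \<times> real. 1 :: real) \<in> borel_measurable borel"
    by measurable
  have law_yx: "tendsto_prob M (emp_mean (\<lambda>z. ipw_weight z * (y z * fst z $ k / q (fst z))))
      (?E (\<lambda>z. y z * fst z $ k))"
    using law[of "\<lambda>x. snd x * fst x $ k"] integrable_monomials(6) by (simp only: fst_conv snd_conv meas)
  have law_x: "tendsto_prob M (emp_mean (\<lambda>z. ipw_weight z * (fst z $ k / q (fst z)))) (?E (\<lambda>z. fst z $ k))"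
    using law[of "\<lambda>x. fst x $ k"] integrable_monomials(4) by (simp only: fst_conv snd_conv meas)
  have law_y: "tendsto_prob M (emp_mean (\<lambda>z. ipw_weight z * (y z / q (fst z)))) (?E y)"
    using law[of snd] integrable_monomials(5) by (simp only: fst_conv snd_conv meas)
  have law_1: "tendsto_prob M (emp_mean (\<lambda>z. ipw_weight z * (1 / q (fst z)))) (?E (\<lambda>_. 1))"
    using law[of "\<lambda>_. 1"] integrable_monomials(3) by (simp only: fst_conv snd_conv meas)
  have lim: "tendsto_prob M (b_term k) (?E (\<lambda>z. y z * fst z $ k) - (\<alpha> + c \<bullet> \<mu>) * ?E (\<lambda>z. fst z $ k)
      - \<mu> $ k * (?E y - (\<alpha> + c \<bullet> \<mu>) * ?E (\<lambda>_. 1)))"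
    unfolding b_term_def[abs_def]
    by (intro tendsto_prob_diff tendsto_prob_mult weighted_outcome_law covariate_mean_law
        law_yx law_x law_y law_1)
  have f_y: "(\<lambda>\<omega>. ?f (fst (Z \<omega>)) * y (Z \<omega>)) =
      (\<lambda>\<omega>. y (Z \<omega>) * fst (Z \<omega>) $ k / q (fst (Z \<omega>)) - \<mu> $ k * (y (Z \<omega>) / q (fst (Z \<omega>))))"
    by (rule ext) (simp add: diff_divide_distrib algebra_simps)
  have f_x: "(\<lambda>\<omega>. ?f (fst (Z \<omega>)) * (c \<bullet> fst (Z \<omega>))) =
      (\<lambda>\<omega>. \<Sum>j\<in>UNIV. c $ j * (fst (Z \<omega>) $ k * fst (Z \<omega>) $ j / q (fst (Z \<omega>))
        - \<mu> $ k * (fst (Z \<omega>) $ j / q (fst (Z \<omega>)))))"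
    unfolding inner_vec_def sum_distrib_left
    by (intro ext sum.cong refl) (simp add: diff_divide_distrib algebra_simps)
  have f_1: "(\<lambda>\<omega>. ?f (fst (Z \<omega>))) =
      (\<lambda>\<omega>. fst (Z \<omega>) $ k / q (fst (Z \<omega>)) - \<mu> $ k * (1 / q (fst (Z \<omega>))))"
    by (rule ext) (simp add: diff_divide_distrib)
  have int_y: "integrable M (\<lambda>\<omega>. ?f (fst (Z \<omega>)) * y (Z \<omega>))"
    and Ey: "expectation (\<lambda>\<omega>. ?f (fst (Z \<omega>)) * y (Z \<omega>)) = ?E (\<lambda>z. y z * fst z $ k) - \<mu> $ k * ?E y"
    unfolding f_y using integrable_monomials by (simp_all del: times_divide_eq_right)
  have int_x: "integrable M (\<lambda>\<omega>. ?f (fst (Z \<omega>)) * (c \<bullet> fst (Z \<omega>)))"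
    unfolding f_x using integrable_monomials by (simp del: times_divide_eq_right)
  have int_1: "integrable M (\<lambda>\<omega>. ?f (fst (Z \<omega>)))"
    and E1: "expectation (\<lambda>\<omega>. ?f (fst (Z \<omega>))) = ?E (\<lambda>z. fst z $ k) - \<mu> $ k * ?E (\<lambda>_. 1)"
    unfolding f_1 using integrable_monomials by (simp_all del: times_divide_eq_right)
  \<comment> \<open>Used with \<open>t = c \<bullet> \<mu>\<close>: the constant
    \<open>\<alpha> + t\<close> that is split off is the mean outcome, whose contribution the
    centring of the outcomes in \<open>lim\<close> removes.\<close>
  have shift: "expectation (\<lambda>\<omega>. F \<omega> * (\<alpha> + G \<omega>)) =
      expectation (\<lambda>\<omega>. F \<omega> * (G \<omega> - t)) + (\<alpha> + t) * expectation F"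
    if "integrable M F" "integrable M (\<lambda>\<omega>. F \<omega> * G \<omega>)" for F G :: "'a \<Rightarrow> real" and t
    using that by (simp add: algebra_simps)
  have "?E (\<lambda>z. y z * fst z $ k) - \<mu> $ k * ?E y = expectation (\<lambda>\<omega>. ?f (fst (Z \<omega>)) * (\<alpha> + c \<bullet> fst (Z \<omega>)))"
    unfolding Ey[symmetric] by (rule regression[OF _ int_y]) measurable
  also have "\<dots> = expectation (\<lambda>\<omega>. ?f (fst (Z \<omega>)) * (c \<bullet> (fst (Z \<omega>) - \<mu>)))
      + (\<alpha> + c \<bullet> \<mu>) * (?E (\<lambda>z. fst z $ k) - \<mu> $ k * ?E (\<lambda>_. 1))"
    unfolding E1[symmetric] inner_diff_right by (rule shift[OF int_1 int_x])
  finally have "?E (\<lambda>z. y z * fst z $ k) - (\<alpha> + c \<bullet> \<mu>) * ?E (\<lambda>z. fst z $ k)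
      - \<mu> $ k * (?E y - (\<alpha> + c \<bullet> \<mu>) * ?E (\<lambda>_. 1)) =
      expectation (\<lambda>\<omega>. ?f (fst (Z \<omega>)) * (c \<bullet> (fst (Z \<omega>) - \<mu>)))"
    by (simp add: algebra_simps)
  with lim show ?thesis by simp
qed

end

section \<open>The linearly modified estimator\<close>

lemma inner_ipw: "v \<bullet> ipw p n x d z = ipw p n x d (\<lambda>i. v \<bullet> z i)" for v :: "real^'n"
  by (simp add: ipw_def inner_diff_right inner_sum_right)

lemma ipw_nth: "ipw p n x d z $ k = ipw p n x d (\<lambda>i. z i $ k)"
  by (simp add: ipw_def sum_component)

lemma sample_mean_nth: "sample_mean n z $ k = (\<Sum>i<n. z i $ k) / real n" for z :: "nat \<Rightarrow> real^'n"
  by (simp add: sample_mean_def sum_component divide_inverse mult.commute)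

lemma sample_mean_nth_nth:
  "sample_mean n z $ k $ l = (\<Sum>i<n. z i $ k $ l) / real n" for z :: "nat \<Rightarrow> real^'n^'m"
  by (simp add: sample_mean_def sum_component divide_inverse mult.commute)

text \<open>The shared slope \<open>c\<close> expresses that the two regressions are parallel; the
  treatment effect is then the difference of the intercepts \<open>\<alpha>T\<close> and
  \<open>\<alpha>C\<close>.\<close>

locale two_arms = iid_sample M borel Zs Z +
    T: treatment_arm M Zs Z p "\<lambda>z. fst (snd z)" "\<lambda>z. fst (snd (snd z))" \<alpha>T c +
    C: treatment_arm M Zs Z "\<lambda>x. 1 - p x" "\<lambda>z. 1 - fst (snd z)" "\<lambda>z. snd (snd (snd z))" \<alpha>C c
  for M :: "'a measure" and Zs :: "nat \<Rightarrow> 'a \<Rightarrow> (real^'k) \<times> real \<times> real \<times> real"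
    and Z :: "'a \<Rightarrow> (real^'k) \<times> real \<times> real \<times> real" and p \<alpha>T \<alpha>C c +
  assumes integrable_inverse_propensities:
      "integrable M (\<lambda>\<omega>. (1 + (norm (fst (Z \<omega>)))\<^sup>2) / (p (fst (Z \<omega>)) * (1 - p (fst (Z \<omega>)))))"
    and invertible_A: "invertible (integral\<^sup>L M (\<lambda>\<omega>.
      outer (fst (Z \<omega>) - T.\<mu>) /\<^sub>R (p (fst (Z \<omega>)) * (1 - p (fst (Z \<omega>))))))"
begin

abbreviation "xs \<omega> i \<equiv> fst (Zs i \<omega>)"
abbreviation "ds \<omega> i \<equiv> fst (snd (Zs i \<omega>))"
abbreviation "yTs \<omega> i \<equiv> fst (snd (snd (Zs i \<omega>)))"
abbreviation "yCs \<omega> i \<equiv> snd (snd (snd (Zs i \<omega>)))"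

text \<open>Written with \<open>inverse\<close> because the entries of a matrix scaled by
  \<open>/\<^sub>R\<close> unfold to a product with \<open>inverse\<close>.\<close>

definition v :: "(real^'k) \<times> real \<times> real \<times> real \<Rightarrow> real" where
  "v z = inverse (p (fst z) * (1 - p (fst z)))"

definition A0 :: "real^'k^'k" where
  "A0 = integral\<^sup>L M (\<lambda>\<omega>. outer (fst (Z \<omega>) - T.\<mu>) /\<^sub>R (p (fst (Z \<omega>)) * (1 - p (fst (Z \<omega>)))))"

lemma v_measurable[measurable]: "v \<in> borel_measurable borel"
  unfolding v_def[abs_def] by measurable

lemma AE_indicators: "AE \<omega> in M. \<forall>i. ds \<omega> i \<in> {0, 1}"
proof -
  have "AE \<omega> in M. fst (snd (Zs i \<omega>)) = 0 \<or> fst (snd (Zs i \<omega>)) = 1" for i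
    by (rule AE_sample) (use T.w01 in auto)
  then show ?thesis by (simp add: AE_all_countable)
qed

lemma integrable_v:
  assumes [measurable]: "g \<in> borel_measurable borel"
    and bound: "\<And>z. \<bar>g z\<bar> \<le> K * (1 + (norm (fst z))\<^sup>2)"
  shows "integrable M (\<lambda>\<omega>. v (Z \<omega>) * g (Z \<omega>))"
proof (rule Bochner_Integration.integrable_bound)
  show "integrable M (\<lambda>\<omega>. K * ((1 + (norm (fst (Z \<omega>)))\<^sup>2) / (p (fst (Z \<omega>)) * (1 - p (fst (Z \<omega>))))))"
    by (rule integrable_mult_right[OF integrable_inverse_propensities])
  show "AE \<omega> in M. norm (v (Z \<omega>) * g (Z \<omega>)) \<le>
      norm (K * ((1 + (norm (fst (Z \<omega>)))\<^sup>2) / (p (fst (Z \<omega>)) * (1 - p (fst (Z \<omega>))))))"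
    using T.q01
  proof eventually_elim
    case (elim \<omega>)
    let ?pq = "p (fst (Z \<omega>)) * (1 - p (fst (Z \<omega>)))"
    have "0 < ?pq" using elim by simp
    then have "\<bar>g (Z \<omega>)\<bar> / ?pq \<le> K * (1 + (norm (fst (Z \<omega>)))\<^sup>2) / ?pq"
      by (intro divide_right_mono bound) auto
    also have "\<dots> \<le> \<bar>K * (1 + (norm (fst (Z \<omega>)))\<^sup>2) / ?pq\<bar>" by (rule abs_ge_self)
    finally have "\<bar>g (Z \<omega>)\<bar> / ?pq \<le> \<bar>K * ((1 + (norm (fst (Z \<omega>)))\<^sup>2) / ?pq)\<bar>"
      by (simp only: times_divide_eq_right)
    moreover have "\<bar>v (Z \<omega>) * g (Z \<omega>)\<bar> = \<bar>g (Z \<omega>)\<bar> / ?pq"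
      unfolding v_def abs_mult using \<open>0 < ?pq\<close> by (simp only: abs_of_pos positive_imp_inverse_positive divide_inverse mult.commute)
    ultimately show ?case unfolding real_norm_def by (simp only:)
  qed
qed measurable

lemma integrable_v_monomials:
  shows "integrable M (\<lambda>\<omega>. v (Z \<omega>))"
    and "integrable M (\<lambda>\<omega>. v (Z \<omega>) * fst (Z \<omega>) $ k)"
    and "integrable M (\<lambda>\<omega>. v (Z \<omega>) * (fst (Z \<omega>) $ k * fst (Z \<omega>) $ j))"
proof -
  have "integrable M (\<lambda>\<omega>. v (Z \<omega>) * 1)"
    by (rule integrable_v[of "\<lambda>_. 1" 1]) simp_all
  then show "integrable M (\<lambda>\<omega>. v (Z \<omega>))" by simp
  show "integrable M (\<lambda>\<omega>. v (Z \<omega>) * fst (Z \<omega>) $ k)"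
    by (rule integrable_v[of _ 1]) (measurable, use monomial_bounds(2)[of _ k 0] in simp)
  show "integrable M (\<lambda>\<omega>. v (Z \<omega>) * (fst (Z \<omega>) $ k * fst (Z \<omega>) $ j))"
    by (rule integrable_v[of _ 2]) (measurable, use monomial_bounds(5)[of _ k j 0] in simp)
qed

text \<open>As in \<open>b_term\<close>, the centring at the sample mean is multiplied out so that
  only empirical means of fixed functions remain.\<close>

lemma A_hat_nth:
  "A_hat p n (xs \<omega>) $ i $ j =
     emp_mean (\<lambda>z. v z * (fst z $ i * fst z $ j)) n \<omega>
     - emp_mean (\<lambda>z. fst z $ i) n \<omega> * emp_mean (\<lambda>z. v z * fst z $ j) n \<omega>
     - emp_mean (\<lambda>z. fst z $ j) n \<omega> * emp_mean (\<lambda>z. v z * fst z $ i) n \<omega>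
     + emp_mean (\<lambda>z. fst z $ i) n \<omega> * emp_mean (\<lambda>z. fst z $ j) n \<omega> * emp_mean v n \<omega>"
proof -
  define m where "m l = emp_mean (\<lambda>z. fst z $ l) n \<omega>" for l
  have m: "sample_mean n (xs \<omega>) $ l = m l" for l
    by (simp add: m_def sample_mean_nth emp_mean_def)
  have "A_hat p n (xs \<omega>) $ i $ j = emp_mean (\<lambda>z. v z * ((fst z $ i - m i) * (fst z $ j - m j))) n \<omega>"
    unfolding A_hat_def sample_mean_nth_nth emp_mean_def by (simp add: outer_def m v_def)
  also have "(\<lambda>z. v z * ((fst z $ i - m i) * (fst z $ j - m j))) =
      (\<lambda>z. v z * (fst z $ i * fst z $ j) - m i * (v z * fst z $ j) - m j * (v z * fst z $ i) + m i * m j * v z)"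
    by (rule ext) (simp add: algebra_simps)
  finally show ?thesis by (simp only: emp_mean_add emp_mean_diff emp_mean_cmult m_def)
qed

lemma v_centered:
  "v z * ((fst z $ i - s) * (fst z $ j - t)) =
    v z * (fst z $ i * fst z $ j) - s * (v z * fst z $ j) - t * (v z * fst z $ i) + s * t * v z"
  by (simp add: algebra_simps)

lemma integrable_v_centered:
  "integrable M (\<lambda>\<omega>. v (Z \<omega>) * ((fst (Z \<omega>) $ i - s) * (fst (Z \<omega>) $ j - t)))"
  unfolding v_centered using integrable_v_monomials by simp

lemma A0_nth: "A0 $ i $ j = expectation (\<lambda>\<omega>. v (Z \<omega>) * ((fst (Z \<omega>) $ i - T.\<mu> $ i) * (fst (Z \<omega>) $ j - T.\<mu> $ j)))"
proof -
  let ?F = "\<lambda>\<omega>. outer (fst (Z \<omega>) - T.\<mu>) /\<^sub>R (p (fst (Z \<omega>)) * (1 - p (fst (Z \<omega>))))"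
  have nth: "?F \<omega> $ k $ l = v (Z \<omega>) * ((fst (Z \<omega>) $ k - T.\<mu> $ k) * (fst (Z \<omega>) $ l - T.\<mu> $ l))" for \<omega> k l
    unfolding v_def outer_def vector_scaleR_component vec_lambda_beta real_scaleR_def vector_minus_component
    by (rule refl)
  have F_axis: "?F \<omega> \<bullet> axis k (axis l 1) = ?F \<omega> $ k $ l" for \<omega> k l
    by (simp only: inner_axis inner_real_def mult_1_right)
  \<comment> \<open>Taking an entry commutes with the matrix-valued integral once the integrand is
    integrable, and that is assembled here from its coordinates.\<close>
  have "integrable M (\<lambda>\<omega>. \<Sum>b\<in>Basis. (?F \<omega> \<bullet> b) *\<^sub>R b)"
  proof (intro Bochner_Integration.integrable_sum integrable_scaleR_left)
    fix b :: "real^'k^'k" assume "b \<in> Basis"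
    then obtain k l where b: "b = axis k (axis l 1)"
      by (auto simp: Basis_vec_def)
    show "integrable M (\<lambda>\<omega>. ?F \<omega> \<bullet> b)"
      unfolding b F_axis nth by (rule integrable_v_centered)
  qed
  then have int: "integrable M ?F" by (simp only: euclidean_representation)
  have "A0 $ i $ j = A0 \<bullet> axis i (axis j 1)"
    by (simp only: inner_axis inner_real_def mult_1_right)
  also have "\<dots> = expectation (\<lambda>\<omega>. ?F \<omega> \<bullet> axis i (axis j 1))"
    unfolding A0_def by (rule integral_inner_left[symmetric], rule int)
  also have "\<dots> = expectation (\<lambda>\<omega>. ?F \<omega> $ i $ j)"
    by (simp only: F_axis)
  finally show ?thesis by (simp only: nth)
qed

lemma v_laws:
  shows "tendsto_prob M (emp_mean v) (expectation (\<lambda>\<omega>. v (Z \<omega>)))"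
    and "tendsto_prob M (emp_mean (\<lambda>z. v z * fst z $ k)) (expectation (\<lambda>\<omega>. v (Z \<omega>) * fst (Z \<omega>) $ k))"
    and "tendsto_prob M (emp_mean (\<lambda>z. v z * (fst z $ k * fst z $ j)))
      (expectation (\<lambda>\<omega>. v (Z \<omega>) * (fst (Z \<omega>) $ k * fst (Z \<omega>) $ j)))"
proof -
  have "v \<in> borel_measurable borel" "(\<lambda>z. v z * fst z $ k) \<in> borel_measurable borel"
    "(\<lambda>z. v z * (fst z $ k * fst z $ j)) \<in> borel_measurable borel" by measurable
  from this[THEN weak_law_of_large_numbers]
  show "tendsto_prob M (emp_mean v) (expectation (\<lambda>\<omega>. v (Z \<omega>)))"
    "tendsto_prob M (emp_mean (\<lambda>z. v z * fst z $ k)) (expectation (\<lambda>\<omega>. v (Z \<omega>) * fst (Z \<omega>) $ k))"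
    "tendsto_prob M (emp_mean (\<lambda>z. v z * (fst z $ k * fst z $ j)))
      (expectation (\<lambda>\<omega>. v (Z \<omega>) * (fst (Z \<omega>) $ k * fst (Z \<omega>) $ j)))"
    using integrable_v_monomials by blast+
qed

lemma A_hat_nth_law: "tendsto_prob M (\<lambda>n \<omega>. A_hat p n (xs \<omega>) $ i $ j) (A0 $ i $ j)"
proof -
  have lim: "tendsto_prob M (\<lambda>n \<omega>. A_hat p n (xs \<omega>) $ i $ j)
      (expectation (\<lambda>\<omega>. v (Z \<omega>) * (fst (Z \<omega>) $ i * fst (Z \<omega>) $ j))
        - T.\<mu> $ i * expectation (\<lambda>\<omega>. v (Z \<omega>) * fst (Z \<omega>) $ j)
        - T.\<mu> $ j * expectation (\<lambda>\<omega>. v (Z \<omega>) * fst (Z \<omega>) $ i)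
        + T.\<mu> $ i * T.\<mu> $ j * expectation (\<lambda>\<omega>. v (Z \<omega>)))"
    unfolding A_hat_nth
    by (intro tendsto_prob_diff tendsto_prob_add tendsto_prob_mult T.covariate_mean_law v_laws)
  have "A0 $ i $ j = expectation (\<lambda>\<omega>. v (Z \<omega>) * (fst (Z \<omega>) $ i * fst (Z \<omega>) $ j))
        - T.\<mu> $ i * expectation (\<lambda>\<omega>. v (Z \<omega>) * fst (Z \<omega>) $ j)
        - T.\<mu> $ j * expectation (\<lambda>\<omega>. v (Z \<omega>) * fst (Z \<omega>) $ i)
        + T.\<mu> $ i * T.\<mu> $ j * expectation (\<lambda>\<omega>. v (Z \<omega>))"
    unfolding A0_nth v_centered using integrable_v_monomials by simp
  with lim show ?thesis by (simp only:)
qed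

lemma A_hat_measurable: "(\<lambda>\<omega>. A_hat p n (xs \<omega>)) \<in> borel_measurable M"
  by (intro borel_measurable_vec_componentwise tendsto_prob_measurable[OF A_hat_nth_law])

lemma A_hat_law: "tendsto_prob M (\<lambda>n \<omega>. A_hat p n (xs \<omega>)) A0"
  by (intro tendsto_prob_vec A_hat_nth_law borel_measurable_vec_componentwise
      tendsto_prob_measurable[OF A_hat_nth_law])

lemma b_hat_measurable: "(\<lambda>\<omega>. b_hat p n (xs \<omega>) (ds \<omega>) (yTs \<omega>) (yCs \<omega>)) \<in> borel_measurable M"
  unfolding b_hat_def sample_mean_def observed_def by measurable

lemma b_hat_nth:
  assumes "\<forall>i. ds \<omega> i \<in> {0, 1}"
  shows "b_hat p n (xs \<omega>) (ds \<omega>) (yTs \<omega>) (yCs \<omega>) $ k = T.b_term k n \<omega> + C.b_term k n \<omega>"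
proof -
  define m where "m = emp_mean (\<lambda>z. fst z $ k) n \<omega>"
  define sT where "sT = emp_mean (\<lambda>z. T.ipw_weight z * fst (snd (snd z))) n \<omega>"
  define sC where "sC = emp_mean (\<lambda>z. C.ipw_weight z * snd (snd (snd z))) n \<omega>"
  have m: "sample_mean n (xs \<omega>) $ k = m"
    by (simp add: m_def sample_mean_nth emp_mean_def)
  \<comment> \<open>For \<open>d\<close> in \<open>{0, 1}\<close> the factor \<open>d\<close> or
    \<open>1 - d\<close> removes the unobserved outcome from \<open>observed\<close>.\<close>
  have obsT: "ds \<omega> i * observed (ds \<omega>) (yTs \<omega>) (yCs \<omega>) i = ds \<omega> i * yTs \<omega> i"
    and obsC: "(1 - ds \<omega> i) * observed (ds \<omega>) (yTs \<omega>) (yCs \<omega>) i = (1 - ds \<omega> i) * yCs \<omega> i" for i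
    using assms[rule_format, of i] by (auto simp: observed_def)
  have sT: "sample_mean n (\<lambda>i. ds \<omega> i * observed (ds \<omega>) (yTs \<omega>) (yCs \<omega>) i / p (xs \<omega> i)) = sT"
    and sC: "sample_mean n (\<lambda>i. (1 - ds \<omega> i) * observed (ds \<omega>) (yTs \<omega>) (yCs \<omega>) i / (1 - p (xs \<omega> i))) = sC"
    unfolding obsT obsC
    by (simp_all add: sT_def sC_def sample_mean_def emp_mean_def T.ipw_weight_def C.ipw_weight_def divide_inverse mult_ac)
  have "b_hat p n (xs \<omega>) (ds \<omega>) (yTs \<omega>) (yCs \<omega>) $ k =
      emp_mean (\<lambda>z. T.ipw_weight z / p (fst z) * (fst (snd (snd z)) - sT) * (fst z $ k - m)
        + C.ipw_weight z / (1 - p (fst z)) * (snd (snd (snd z)) - sC) * (fst z $ k - m)) n \<omega>"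
    unfolding b_hat_def sT sC sample_mean_nth emp_mean_def
    by (simp add: m T.ipw_weight_def C.ipw_weight_def power2_eq_square distrib_right)
  also have "(\<lambda>z. T.ipw_weight z / p (fst z) * (fst (snd (snd z)) - sT) * (fst z $ k - m)
        + C.ipw_weight z / (1 - p (fst z)) * (snd (snd (snd z)) - sC) * (fst z $ k - m)) =
      (\<lambda>z. (T.ipw_weight z * (fst (snd (snd z)) * fst z $ k / p (fst z))
          - sT * (T.ipw_weight z * (fst z $ k / p (fst z)))
          - m * (T.ipw_weight z * (fst (snd (snd z)) / p (fst z)) - sT * (T.ipw_weight z * (1 / p (fst z)))))
        + (C.ipw_weight z * (snd (snd (snd z)) * fst z $ k / (1 - p (fst z)))
          - sC * (C.ipw_weight z * (fst z $ k / (1 - p (fst z))))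
          - m * (C.ipw_weight z * (snd (snd (snd z)) / (1 - p (fst z))) - sC * (C.ipw_weight z * (1 / (1 - p (fst z)))))))"
    \<comment> \<open>With division turned into multiplication by \<open>inverse\<close> the
      identity is polynomial, so it holds also at points where \<open>p\<close> is 0 or 1.\<close>
    by (rule ext) (simp only: divide_inverse, simp add: algebra_simps)
  finally show ?thesis
    unfolding T.b_term_def C.b_term_def by (simp only: emp_mean_add emp_mean_diff emp_mean_cmult m_def sT_def sC_def)
qed

text \<open>The two arms contribute \<open>1 / p\<close> and \<open>1 / (1 - p)\<close>, whose sum is \<open>1 / (p * (1 - p))\<close>.\<close>

lemma b_hat_law: "tendsto_prob M (\<lambda>n \<omega>. b_hat p n (xs \<omega>) (ds \<omega>) (yTs \<omega>) (yCs \<omega>)) (A0 *v c)"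
proof (rule tendsto_prob_vec)
  fix k
  let ?h = "\<lambda>\<omega>. (fst (Z \<omega>) $ k - T.\<mu> $ k) * (c \<bullet> (fst (Z \<omega>) - T.\<mu>))"
  \<comment> \<open>Cauchy-Schwarz bounds both factors by multiples of the norm of
    \<open>x - T.\<mu>\<close>, and the squared norm of a difference is at most twice the sum of the
    squared norms. As \<open>t\<close> is arbitrary, the bound fits the outcome of either
    arm.\<close>
  have bound: "\<bar>(x $ k - T.\<mu> $ k) * (c \<bullet> (x - T.\<mu>))\<bar> \<le>
      norm c * (2 * (1 + (norm T.\<mu>)\<^sup>2)) * (1 + (norm x)\<^sup>2 + t\<^sup>2)" for x :: "real^'k" and t :: real
  proof -
    have "\<bar>(x $ k - T.\<mu> $ k) * (c \<bullet> (x - T.\<mu>))\<bar> \<le> norm (x - T.\<mu>) * (norm c * norm (x - T.\<mu>))"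
      unfolding abs_mult using component_le_norm_cart[of "x - T.\<mu>" k] Cauchy_Schwarz_ineq2[of c "x - T.\<mu>"]
      by (intro mult_mono) auto
    also have "\<dots> = norm c * (norm (x - T.\<mu>))\<^sup>2" by (simp add: power2_eq_square)
    also have "\<dots> \<le> norm c * (2 * (1 + (norm T.\<mu>)\<^sup>2) * (1 + (norm x)\<^sup>2 + t\<^sup>2))"
    proof (rule mult_left_mono)
      have "(norm (x - T.\<mu>))\<^sup>2 \<le> (norm x + norm T.\<mu>)\<^sup>2"
        by (intro power_mono norm_triangle_ineq4) auto
      also have "\<dots> \<le> 2 * (norm x)\<^sup>2 + 2 * (norm T.\<mu>)\<^sup>2"
        using sum_squares_bound[of "norm x" "norm T.\<mu>"] by (simp add: power2_sum)
      also have "\<dots> \<le> 2 * (1 + (norm T.\<mu>)\<^sup>2) * (1 + (norm x)\<^sup>2 + t\<^sup>2)"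
        by (simp add: distrib_left distrib_right)
      finally show "(norm (x - T.\<mu>))\<^sup>2 \<le> 2 * (1 + (norm T.\<mu>)\<^sup>2) * (1 + (norm x)\<^sup>2 + t\<^sup>2)" .
    qed simp
    finally show ?thesis by (simp only: mult.assoc)
  qed
  have intT: "integrable M (\<lambda>\<omega>. ?h \<omega> / p (fst (Z \<omega>)))"
    by (rule T.integrable_divide[OF _ bound]) measurable
  have intC: "integrable M (\<lambda>\<omega>. ?h \<omega> / (1 - p (fst (Z \<omega>))))"
    by (rule C.integrable_divide[OF _ bound]) measurable
  have "(A0 *v c) $ k = (\<Sum>j\<in>UNIV. A0 $ k $ j * c $ j)"
    by (simp add: matrix_vector_mult_def)
  also have "\<dots> = (\<Sum>j\<in>UNIV. expectation (\<lambda>\<omega>. c $ j * (v (Z \<omega>) * ((fst (Z \<omega>) $ k - T.\<mu> $ k) * (fst (Z \<omega>) $ j - T.\<mu> $ j)))))"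
    by (simp add: A0_nth mult.commute)
  also have "\<dots> = expectation (\<lambda>\<omega>. \<Sum>j\<in>UNIV. c $ j * (v (Z \<omega>) * ((fst (Z \<omega>) $ k - T.\<mu> $ k) * (fst (Z \<omega>) $ j - T.\<mu> $ j))))"
  proof (rule Bochner_Integration.integral_sum[symmetric])
    fix j
    show "integrable M (\<lambda>\<omega>. c $ j * (v (Z \<omega>) * ((fst (Z \<omega>) $ k - T.\<mu> $ k) * (fst (Z \<omega>) $ j - T.\<mu> $ j))))"
      by (rule integrable_mult_right[OF integrable_v_centered])
  qed
  also have "\<dots> = expectation (\<lambda>\<omega>. ?h \<omega> / p (fst (Z \<omega>)) + ?h \<omega> / (1 - p (fst (Z \<omega>))))"
  proof (rule integral_cong_AE)
    show "AE \<omega> in M. (\<Sum>j\<in>UNIV. c $ j * (v (Z \<omega>) * ((fst (Z \<omega>) $ k - T.\<mu> $ k) * (fst (Z \<omega>) $ j - T.\<mu> $ j)))) =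
        ?h \<omega> / p (fst (Z \<omega>)) + ?h \<omega> / (1 - p (fst (Z \<omega>)))"
      using T.q01
    proof eventually_elim
      case (elim \<omega>)
      have "(\<Sum>j\<in>UNIV. c $ j * (v (Z \<omega>) * ((fst (Z \<omega>) $ k - T.\<mu> $ k) * (fst (Z \<omega>) $ j - T.\<mu> $ j)))) =
          v (Z \<omega>) * ?h \<omega>"
        by (simp add: inner_vec_def sum_distrib_left mult_ac)
      also have "\<dots> = ?h \<omega> * (1 / p (fst (Z \<omega>)) + 1 / (1 - p (fst (Z \<omega>))))"
        using elim by (simp add: v_def field_simps)
      finally show ?case by (simp add: distrib_left)
    qed
  qed measurable
  also have "\<dots> = expectation (\<lambda>\<omega>. ?h \<omega> / p (fst (Z \<omega>))) + expectation (\<lambda>\<omega>. ?h \<omega> / (1 - p (fst (Z \<omega>))))"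
    by (rule Bochner_Integration.integral_add[OF intT intC])
  finally have "tendsto_prob M (\<lambda>n \<omega>. T.b_term k n \<omega> + C.b_term k n \<omega>) ((A0 *v c) $ k)"
    using tendsto_prob_add[OF T.b_term_law[of k] C.b_term_law[of k]] by (simp only:)
  then show "tendsto_prob M (\<lambda>n \<omega>. b_hat p n (xs \<omega>) (ds \<omega>) (yTs \<omega>) (yCs \<omega>) $ k) ((A0 *v c) $ k)"
  proof (rule tendsto_prob_cong_AE)
    show "(\<lambda>\<omega>. b_hat p n (xs \<omega>) (ds \<omega>) (yTs \<omega>) (yCs \<omega>) $ k) \<in> borel_measurable M" for n
      using b_hat_measurable by measurable
    show "AE \<omega> in M. b_hat p n (xs \<omega>) (ds \<omega>) (yTs \<omega>) (yCs \<omega>) $ k = T.b_term k n \<omega> + C.b_term k n \<omega>" for n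
      using AE_indicators by eventually_elim (rule b_hat_nth)
  qed
qed (rule b_hat_measurable)

abbreviation "alpha n \<omega> \<equiv> alpha_hat p n (xs \<omega>) (ds \<omega>) (yTs \<omega>) (yCs \<omega>)"

lemma alpha_measurable: "alpha n \<in> borel_measurable M"
  unfolding alpha_hat_def by (intro borel_measurable_matrix_inv_mult A_hat_measurable b_hat_measurable)

lemma alpha_law: "tendsto_prob M (\<lambda>n \<omega>. alpha n \<omega> $ k) (c $ k)"
proof -
  have det: "det A0 \<noteq> 0"
    using invertible_A by (simp add: A0_def invertible_det_nz)
  have "matrix_inv A0 *v (A0 *v c) = c"
    unfolding matrix_inv_mult_cramer[OF det] by (rule cramer[OF det, THEN iffD1, OF refl, symmetric])
  then have "tendsto_prob M alpha c"
    using tendsto_prob_continuous2[OF A_hat_law b_hat_law isCont_matrix_inv_mult[OF det]]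
      borel_measurable_matrix_inv_mult[OF A_hat_measurable b_hat_measurable]
    by (simp add: alpha_hat_def[abs_def])
  then show ?thesis
    using alpha_measurable by (intro tendsto_prob_vec_nth) measurable
qed

end

section \<open>Exact expansion of the estimator and its limit law\<close>

context two_arms
begin

lemma ipw_emp_mean:
  fixes h :: "(real^'k) \<times> real \<times> real \<times> real \<Rightarrow> real"
  shows "ipw p n (xs \<omega>) (ds \<omega>) (\<lambda>i. h (Zs i \<omega>)) =
    emp_mean (\<lambda>z. T.ipw_weight z * h z) n \<omega> / emp_mean T.ipw_weight n \<omega> -
    emp_mean (\<lambda>z. C.ipw_weight z * h z) n \<omega> / emp_mean C.ipw_weight n \<omega>"
proof -
  \<comment> \<open>The factors \<open>1 / n\<close> cancel; at \<open>n = 0\<close> both sides are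
    0.\<close>
  have ratio: "emp_mean f n \<omega> / emp_mean g n \<omega> = (\<Sum>i<n. f (Zs i \<omega>)) / (\<Sum>i<n. g (Zs i \<omega>))" for f g
    by (cases "n = 0") (simp_all add: emp_mean_def)
  show ?thesis
    unfolding ratio by (simp add: ipw_def T.ipw_weight_def C.ipw_weight_def divide_inverse mult_ac)
qed

text \<open>Each ratio is an average with weights of total 1, so subtracting the constant
  \<open>T.\<mu> $ k\<close> from the covariates shifts both ratios equally and drops out of the
  difference. The gain is that both numerators have mean zero. A ratio with vanishing denominator is
  0 and would not shift.\<close>

lemma ipw_covariate:
  assumes "emp_mean T.ipw_weight n \<omega> \<noteq> 0" and "emp_mean C.ipw_weight n \<omega> \<noteq> 0"
  shows "ipw p n (xs \<omega>) (ds \<omega>) (xs \<omega>) $ k =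
    emp_mean (\<lambda>z. T.ipw_weight z * (fst z $ k - T.\<mu> $ k)) n \<omega> / emp_mean T.ipw_weight n \<omega> -
    emp_mean (\<lambda>z. C.ipw_weight z * (fst z $ k - T.\<mu> $ k)) n \<omega> / emp_mean C.ipw_weight n \<omega>"
proof -
  have center: "emp_mean (\<lambda>z. f z * (fst z $ k - T.\<mu> $ k)) n \<omega> =
      emp_mean (\<lambda>z. f z * fst z $ k) n \<omega> - T.\<mu> $ k * emp_mean f n \<omega>" for f
    unfolding emp_mean_cmult[symmetric] emp_mean_diff[symmetric] by (simp add: algebra_simps)
  show ?thesis
    unfolding ipw_nth ipw_emp_mean[of n \<omega> "\<lambda>z. fst z $ k"] center using assms
    by (simp add: diff_divide_distrib)
qed

text \<open>Normalised weights reproduce constants without error, so the intercepts contribute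
  exactly \<open>\<alpha>T - \<alpha>C\<close>, and the common slope collects the linear parts of
  both arms in the covariate contrast.\<close>

lemma ipw_observed:
  assumes d: "\<forall>i. ds \<omega> i \<in> {0, 1}"
    and "emp_mean T.ipw_weight n \<omega> \<noteq> 0" and "emp_mean C.ipw_weight n \<omega> \<noteq> 0"
  shows "ipw p n (xs \<omega>) (ds \<omega>) (observed (ds \<omega>) (yTs \<omega>) (yCs \<omega>)) =
    (\<alpha>T - \<alpha>C) + c \<bullet> ipw p n (xs \<omega>) (ds \<omega>) (xs \<omega>) +
    emp_mean (\<lambda>z. T.ipw_weight z * T.residual z) n \<omega> / emp_mean T.ipw_weight n \<omega> -
    emp_mean (\<lambda>z. C.ipw_weight z * C.residual z) n \<omega> / emp_mean C.ipw_weight n \<omega>"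
proof -
  let ?h = "\<lambda>z. fst (snd z) * fst (snd (snd z)) + (1 - fst (snd z)) * snd (snd (snd z))"
  have obs: "observed (ds \<omega>) (yTs \<omega>) (yCs \<omega>) = (\<lambda>i. ?h (Zs i \<omega>))"
    by (rule ext) (simp add: observed_def)
  have yT: "yTs \<omega> i = \<alpha>T + c \<bullet> xs \<omega> i + T.residual (Zs i \<omega>)" for i
    by (simp add: T.residual_def)
  have wT: "T.ipw_weight (Zs i \<omega>) * ?h (Zs i \<omega>) = T.ipw_weight (Zs i \<omega>) * yTs \<omega> i" for i
    using d[rule_format, of i] by (auto simp: T.ipw_weight_def)
  have "T.ipw_weight (Zs i \<omega>) * ?h (Zs i \<omega>) =
      \<alpha>T * T.ipw_weight (Zs i \<omega>) + T.ipw_weight (Zs i \<omega>) * (c \<bullet> xs \<omega> i)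
      + T.ipw_weight (Zs i \<omega>) * T.residual (Zs i \<omega>)" for i
    by (rule trans[OF wT], subst yT) (simp add: algebra_simps)
  then have T: "emp_mean (\<lambda>z. T.ipw_weight z * ?h z) n \<omega> =
      emp_mean (\<lambda>z. \<alpha>T * T.ipw_weight z + T.ipw_weight z * (c \<bullet> fst z) + T.ipw_weight z * T.residual z) n \<omega>"
    by (simp only: emp_mean_def)
  have yC: "yCs \<omega> i = \<alpha>C + c \<bullet> xs \<omega> i + C.residual (Zs i \<omega>)" for i
    by (simp add: C.residual_def)
  have wC: "C.ipw_weight (Zs i \<omega>) * ?h (Zs i \<omega>) = C.ipw_weight (Zs i \<omega>) * yCs \<omega> i" for i
    using d[rule_format, of i] by (auto simp: C.ipw_weight_def)
  have "C.ipw_weight (Zs i \<omega>) * ?h (Zs i \<omega>) =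
      \<alpha>C * C.ipw_weight (Zs i \<omega>) + C.ipw_weight (Zs i \<omega>) * (c \<bullet> xs \<omega> i)
      + C.ipw_weight (Zs i \<omega>) * C.residual (Zs i \<omega>)" for i
    by (rule trans[OF wC], subst yC) (simp add: algebra_simps)
  then have C: "emp_mean (\<lambda>z. C.ipw_weight z * ?h z) n \<omega> =
      emp_mean (\<lambda>z. \<alpha>C * C.ipw_weight z + C.ipw_weight z * (c \<bullet> fst z) + C.ipw_weight z * C.residual z) n \<omega>"
    by (simp only: emp_mean_def)
  show ?thesis
    unfolding obs inner_ipw ipw_emp_mean[of n \<omega> ?h] ipw_emp_mean[of n \<omega> "\<lambda>z. c \<bullet> fst z"] T C
      emp_mean_add emp_mean_cmult
    using assms(2,3) by (simp add: add_divide_distrib)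
qed

text \<open>For a constant conditional effect this is the efficient influence function: its usual
  third term, the conditional effect minus its mean, is zero.\<close>

definition influence :: "(real^'k) \<times> real \<times> real \<times> real \<Rightarrow> real" where
  "influence z = T.ipw_weight z * T.residual z - C.ipw_weight z * C.residual z"

text \<open>Each product has on the left a scaled empirical mean of a centred function, bounded in
  second moment, and on the right a factor that tends to 0 in probability. The random denominators
  and the error of \<open>alpha\<close> all belong to the right factor.\<close>

definition remainder :: "nat \<Rightarrow> 'a \<Rightarrow> real" where
  "remainder n \<omega> =
    sqrt (real n) * emp_mean (\<lambda>z. T.ipw_weight z * T.residual z) n \<omega> * (1 / emp_mean T.ipw_weight n \<omega> - 1) -
    sqrt (real n) * emp_mean (\<lambda>z. C.ipw_weight z * C.residual z) n \<omega> * (1 / emp_mean C.ipw_weight n \<omega> - 1) +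
    (\<Sum>k\<in>UNIV.
      sqrt (real n) * emp_mean (\<lambda>z. T.ipw_weight z * (fst z $ k - T.\<mu> $ k)) n \<omega> *
        ((c $ k - alpha n \<omega> $ k) / emp_mean T.ipw_weight n \<omega>) -
      sqrt (real n) * emp_mean (\<lambda>z. C.ipw_weight z * (fst z $ k - T.\<mu> $ k)) n \<omega> *
        ((c $ k - alpha n \<omega> $ k) / emp_mean C.ipw_weight n \<omega>))"

abbreviation "estimator n \<omega> \<equiv> beta_lm p n (xs \<omega>) (ds \<omega>) (yTs \<omega>) (yCs \<omega>)"

lemma estimator_expansion:
  assumes "\<forall>i. ds \<omega> i \<in> {0, 1}"
    and "emp_mean T.ipw_weight n \<omega> \<noteq> 0" and "emp_mean C.ipw_weight n \<omega> \<noteq> 0"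
  shows "sqrt (real n) * (estimator n \<omega> - (\<alpha>T - \<alpha>C)) =
    sqrt (real n) * emp_mean influence n \<omega> + remainder n \<omega>"
proof -
  let ?s = "sqrt (real n)"
  let ?rT = "emp_mean (\<lambda>z. T.ipw_weight z * T.residual z) n \<omega>"
  let ?rC = "emp_mean (\<lambda>z. C.ipw_weight z * C.residual z) n \<omega>"
  let ?mT = "emp_mean T.ipw_weight n \<omega>" and ?mC = "emp_mean C.ipw_weight n \<omega>"
  let ?x = "ipw p n (xs \<omega>) (ds \<omega>) (xs \<omega>)"
  have "estimator n \<omega> - (\<alpha>T - \<alpha>C) = (c - alpha n \<omega>) \<bullet> ?x + ?rT / ?mT - ?rC / ?mC"
    unfolding beta_lm_def ipw_observed[OF assms] by (simp add: inner_diff_left)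
  moreover have "?s * ((c - alpha n \<omega>) \<bullet> ?x) =
      (\<Sum>k\<in>UNIV.
        ?s * emp_mean (\<lambda>z. T.ipw_weight z * (fst z $ k - T.\<mu> $ k)) n \<omega> * ((c $ k - alpha n \<omega> $ k) / ?mT) -
        ?s * emp_mean (\<lambda>z. C.ipw_weight z * (fst z $ k - T.\<mu> $ k)) n \<omega> * ((c $ k - alpha n \<omega> $ k) / ?mC))"
    unfolding inner_vec_def sum_distrib_left ipw_covariate[OF assms(2,3)]
    by (intro sum.cong refl) (simp add: right_diff_distrib mult_ac)
  moreover have "emp_mean influence n \<omega> = ?rT - ?rC"
    unfolding influence_def[abs_def] emp_mean_diff ..
  moreover have "s * (a + rT / mT - rC / mC) = s * (rT - rC) + (s * rT * (1 / mT - 1) - s * rC * (1 / mC - 1) + S)"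
    if "s * a = S" for s a rT mT rC mC S :: real
    unfolding that[symmetric] by (simp add: algebra_simps)
  ultimately show ?thesis
    unfolding remainder_def by presburger
qed

lemma remainder_law: "tendsto_prob M remainder 0"
proof -
  have inv: "tendsto_prob M (\<lambda>n \<omega>. 1 / emp_mean f n \<omega> - 1) 0" if "tendsto_prob M (emp_mean f) 1" for f
    using tendsto_prob_diff[OF tendsto_prob_divide[OF tendsto_prob_const[of 1] that] tendsto_prob_const[of 1]]
    by simp
  have quot: "tendsto_prob M (\<lambda>n \<omega>. (c $ k - alpha n \<omega> $ k) / emp_mean f n \<omega>) 0"
    if "tendsto_prob M (emp_mean f) 1" for f k
    using tendsto_prob_divide[OF tendsto_prob_diff[OF tendsto_prob_const[of "c $ k"] alpha_law[of k]] that]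
    by simp
  have scaled: "tendsto_prob M (\<lambda>n \<omega>. sqrt (real n) * emp_mean f n \<omega> * V n \<omega>) 0"
    if [measurable]: "f \<in> borel_measurable borel" and "integrable M (\<lambda>\<omega>. (f (Z \<omega>))\<^sup>2)"
      "expectation (\<lambda>\<omega>. f (Z \<omega>)) = 0" and "tendsto_prob M V 0" for f V
    by (rule tendsto_prob_mult_bounded_moment[OF _ integrable_sqrt_emp_mean[OF that(1-3)]
          expectation_sqrt_emp_mean[OF that(1-3)] that(4)]) measurable
  have T1: "tendsto_prob M (\<lambda>n \<omega>. sqrt (real n) * emp_mean (\<lambda>z. T.ipw_weight z * T.residual z) n \<omega> *
      (1 / emp_mean T.ipw_weight n \<omega> - 1)) 0"
    by (rule scaled[OF _ T.integrable_weighted_residual_square T.weighted_residual_mean_zero inv[OF T.weight_law]])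
       measurable
  have C1: "tendsto_prob M (\<lambda>n \<omega>. sqrt (real n) * emp_mean (\<lambda>z. C.ipw_weight z * C.residual z) n \<omega> *
      (1 / emp_mean C.ipw_weight n \<omega> - 1)) 0"
    by (rule scaled[OF _ C.integrable_weighted_residual_square C.weighted_residual_mean_zero inv[OF C.weight_law]])
       measurable
  have T2: "tendsto_prob M (\<lambda>n \<omega>. sqrt (real n) * emp_mean (\<lambda>z. T.ipw_weight z * (fst z $ k - T.\<mu> $ k)) n \<omega> *
      ((c $ k - alpha n \<omega> $ k) / emp_mean T.ipw_weight n \<omega>)) 0" for k
    by (rule scaled[OF _ T.integrable_weighted_covariate_square T.weighted_covariate_mean_zero quot[OF T.weight_law]])
       measurable
  have C2: "tendsto_prob M (\<lambda>n \<omega>. sqrt (real n) * emp_mean (\<lambda>z. C.ipw_weight z * (fst z $ k - T.\<mu> $ k)) n \<omega> *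
      ((c $ k - alpha n \<omega> $ k) / emp_mean C.ipw_weight n \<omega>)) 0" for k
    by (rule scaled[OF _ C.integrable_weighted_covariate_square C.weighted_covariate_mean_zero quot[OF C.weight_law]])
       measurable
  have "tendsto_prob M remainder (0 - 0 + 0)"
    unfolding remainder_def[abs_def]
    by (intro tendsto_prob_add tendsto_prob_diff[OF T1 C1] tendsto_prob_sum_zero finite
        tendsto_prob_diff[OF T2 C2, unfolded diff_0_right])
  then show ?thesis by simp
qed

lemma estimator_measurable: "estimator n \<in> borel_measurable M"
proof -
  note [measurable] = alpha_measurable
  show ?thesis unfolding beta_lm_def ipw_def observed_def by measurable
qed

lemma
  shows integrable_influence_square: "integrable M (\<lambda>\<omega>. (influence (Z \<omega>))\<^sup>2)"
    and expectation_influence_square: "expectation (\<lambda>\<omega>. (influence (Z \<omega>))\<^sup>2) =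
      expectation (\<lambda>\<omega>. (T.residual (Z \<omega>))\<^sup>2 / p (fst (Z \<omega>))) +
      expectation (\<lambda>\<omega>. (C.residual (Z \<omega>))\<^sup>2 / (1 - p (fst (Z \<omega>))))"
    and expectation_influence: "expectation (\<lambda>\<omega>. influence (Z \<omega>)) = 0"
proof -
  let ?T = "\<lambda>\<omega>. T.ipw_weight (Z \<omega>) * T.residual (Z \<omega>)" and ?C = "\<lambda>\<omega>. C.ipw_weight (Z \<omega>) * C.residual (Z \<omega>)"
  have [measurable]: "influence \<in> borel_measurable borel"
    unfolding influence_def[abs_def] by measurable
  \<comment> \<open>For a treatment indicator in \<open>{0, 1}\<close> one of the two weights is 0,
    so the square of the difference is the sum of the squares.\<close>
  have eq: "AE \<omega> in M. (influence (Z \<omega>))\<^sup>2 = (?T \<omega>)\<^sup>2 + (?C \<omega>)\<^sup>2"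
    using T.w01 by eventually_elim (auto simp: influence_def T.ipw_weight_def C.ipw_weight_def)
  have sum: "integrable M (\<lambda>\<omega>. (?T \<omega>)\<^sup>2 + (?C \<omega>)\<^sup>2)"
    by (intro Bochner_Integration.integrable_add T.integrable_weighted_residual_square
        C.integrable_weighted_residual_square)
  have "integrable M (\<lambda>\<omega>. (influence (Z \<omega>))\<^sup>2) \<longleftrightarrow> integrable M (\<lambda>\<omega>. (?T \<omega>)\<^sup>2 + (?C \<omega>)\<^sup>2)"
    by (rule integrable_cong_AE[OF _ _ eq]) measurable
  then show "integrable M (\<lambda>\<omega>. (influence (Z \<omega>))\<^sup>2)" using sum by blast
  have "expectation (\<lambda>\<omega>. (influence (Z \<omega>))\<^sup>2) = expectation (\<lambda>\<omega>. (?T \<omega>)\<^sup>2 + (?C \<omega>)\<^sup>2)"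
    by (rule integral_cong_AE[OF _ _ eq]) measurable
  also have "\<dots> = expectation (\<lambda>\<omega>. (?T \<omega>)\<^sup>2) + expectation (\<lambda>\<omega>. (?C \<omega>)\<^sup>2)"
    by (rule Bochner_Integration.integral_add[OF T.integrable_weighted_residual_square
        C.integrable_weighted_residual_square])
  finally show "expectation (\<lambda>\<omega>. (influence (Z \<omega>))\<^sup>2) =
      expectation (\<lambda>\<omega>. (T.residual (Z \<omega>))\<^sup>2 / p (fst (Z \<omega>))) +
      expectation (\<lambda>\<omega>. (C.residual (Z \<omega>))\<^sup>2 / (1 - p (fst (Z \<omega>))))"
    by (simp only: T.expectation_weighted_residual_square C.expectation_weighted_residual_square)
  have "integrable M ?T"
    by (rule square_integrable_imp_integrable[OF _ T.integrable_weighted_residual_square]) measurable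
  moreover have "integrable M ?C"
    by (rule square_integrable_imp_integrable[OF _ C.integrable_weighted_residual_square]) measurable
  ultimately have "expectation (\<lambda>\<omega>. ?T \<omega> - ?C \<omega>) = expectation ?T - expectation ?C"
    by (rule Bochner_Integration.integral_diff)
  then show "expectation (\<lambda>\<omega>. influence (Z \<omega>)) = 0"
    unfolding influence_def T.weighted_residual_mean_zero C.weighted_residual_mean_zero by simp
qed

theorem estimator_asymptotically_normal:
  "weak_conv_m (\<lambda>n. distr M borel (\<lambda>\<omega>. sqrt (real n) * (estimator n \<omega> - (\<alpha>T - \<alpha>C))))
    (centered_normal (expectation (\<lambda>\<omega>. (T.residual (Z \<omega>))\<^sup>2 / p (fst (Z \<omega>))) +
      expectation (\<lambda>\<omega>. (C.residual (Z \<omega>))\<^sup>2 / (1 - p (fst (Z \<omega>))))))"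
proof -
  note [measurable] = estimator_measurable
  have infl[measurable]: "influence \<in> borel_measurable borel"
    unfolding influence_def[abs_def] by measurable
  let ?S = "\<lambda>n \<omega>. sqrt (real n) * (estimator n \<omega> - (\<alpha>T - \<alpha>C))"
  let ?I = "\<lambda>n \<omega>. sqrt (real n) * emp_mean influence n \<omega>"
  have weights: "tendsto_prob M (\<lambda>n \<omega>. emp_mean T.ipw_weight n \<omega> * emp_mean C.ipw_weight n \<omega>) 1"
    using tendsto_prob_mult[OF T.weight_law C.weight_law] by simp
  \<comment> \<open>The difference of \<open>?S\<close> and \<open>?I\<close> is used in place of
    \<open>remainder\<close>, since the two agree only where no weight mean vanishes. Convergence of
    the weights makes the complement negligible.\<close>
  have R: "tendsto_prob M (\<lambda>n \<omega>. ?S n \<omega> - ?I n \<omega>) 0"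
  proof (rule tendsto_prob_compose2[OF remainder_law weights])
    fix e :: real assume "e > 0"
    \<comment> \<open>A product at distance less than 1 from 1 is nonzero, and this single condition
      keeps both denominators away from 0.\<close>
    let ?d = "min e 1"
    have small: "AE \<omega> in M. dist (remainder n \<omega>) 0 < ?d \<longrightarrow>
        dist (emp_mean T.ipw_weight n \<omega> * emp_mean C.ipw_weight n \<omega>) 1 < ?d \<longrightarrow>
        dist (?S n \<omega> - ?I n \<omega>) 0 < e" for n
      using AE_indicators
    proof eventually_elim
      case (elim \<omega>)
      show ?case
      proof (intro impI)
        assume small: "dist (remainder n \<omega>) 0 < ?d"
          and near: "dist (emp_mean T.ipw_weight n \<omega> * emp_mean C.ipw_weight n \<omega>) 1 < ?d"
        from near have "emp_mean T.ipw_weight n \<omega> * emp_mean C.ipw_weight n \<omega> \<noteq> 0" by auto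
        then have "emp_mean T.ipw_weight n \<omega> \<noteq> 0" "emp_mean C.ipw_weight n \<omega> \<noteq> 0" by auto
        from estimator_expansion[OF elim this] small show "dist (?S n \<omega> - ?I n \<omega>) 0 < e" by simp
      qed
    qed
    have "\<forall>\<^sub>F n in sequentially. AE \<omega> in M. dist (remainder n \<omega>) 0 < ?d \<longrightarrow>
        dist (emp_mean T.ipw_weight n \<omega> * emp_mean C.ipw_weight n \<omega>) 1 < ?d \<longrightarrow>
        dist (?S n \<omega> - ?I n \<omega>) 0 < e"
      by (rule always_eventually, rule allI, rule small)
    then show "\<exists>d>0. \<forall>\<^sub>F n in sequentially. AE \<omega> in M. dist (remainder n \<omega>) 0 < d \<longrightarrow>
        dist (emp_mean T.ipw_weight n \<omega> * emp_mean C.ipw_weight n \<omega>) 1 < d \<longrightarrow>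
        dist (?S n \<omega> - ?I n \<omega>) 0 < e"
      using \<open>e > 0\<close> by (intro exI[of _ ?d] conjI) simp_all
  qed measurable
  have "weak_conv_m (\<lambda>n. distr M borel (\<lambda>\<omega>. ?I n \<omega> + (?S n \<omega> - ?I n \<omega>)))
      (centered_normal (expectation (\<lambda>\<omega>. (influence (Z \<omega>))\<^sup>2)))"
    by (rule weak_conv_add_tendsto_prob[OF _ R real_distribution_centered_normal
        char_sqrt_emp_mean_tendsto[OF infl integrable_influence_square expectation_influence]]) measurable
  then show ?thesis by (simp only: expectation_influence_square add_diff_cancel_left' add_diff_eq)
qed

end

section \<open>Conditional moments and the efficiency bound\<close>

context prob_space
begin

text \<open>\<open>cexp\<close> and \<open>m (X)\<close> agree almost surely, so centring at either
  gives the same conditional variance. The factor \<open>1 / f (X)\<close> is a function of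
  \<open>X\<close> and passes under the conditional expectation, which integration then
  removes.\<close>

lemma
  fixes X :: "'a \<Rightarrow> real^'k" and Y :: "'a \<Rightarrow> real"
  assumes X[measurable]: "X \<in> borel_measurable M" and Y[measurable]: "Y \<in> borel_measurable M"
    and f[measurable]: "f \<in> borel_measurable borel" and m[measurable]: "m \<in> borel_measurable borel"
    and mean: "AE \<omega> in M. cexp M X Y \<omega> = m (X \<omega>)"
    and int: "integrable M (\<lambda>\<omega>. (Y \<omega> - m (X \<omega>))\<^sup>2 / f (X \<omega>))"
  shows integrable_cvar_divide: "integrable M (\<lambda>\<omega>. cvar M X Y \<omega> / f (X \<omega>))"
    and expectation_cvar_divide:
      "expectation (\<lambda>\<omega>. cvar M X Y \<omega> / f (X \<omega>)) = expectation (\<lambda>\<omega>. (Y \<omega> - m (X \<omega>))\<^sup>2 / f (X \<omega>))"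
proof -
  interpret sigma_finite_subalgebra M "vimage_algebra (space M) X borel"
    by (rule sigma_finite_subalgebra_vimage[OF X])
  let ?R = "\<lambda>\<omega>. (Y \<omega> - m (X \<omega>))\<^sup>2"
  have "AE \<omega> in M. cexp M X (\<lambda>\<omega>. (Y \<omega> - cexp M X Y \<omega>)\<^sup>2) \<omega> = cexp M X ?R \<omega>"
  proof (rule real_cond_exp_cong)
    show "AE \<omega> in M. (Y \<omega> - cexp M X Y \<omega>)\<^sup>2 = ?R \<omega>"
      using mean by eventually_elim simp
  qed measurable
  then have eq: "AE \<omega> in M. cvar M X Y \<omega> / f (X \<omega>) = 1 / f (X \<omega>) * cexp M X ?R \<omega>"
    unfolding cvar_def by eventually_elim simp
  have int': "integrable M (\<lambda>\<omega>. 1 / f (X \<omega>) * ?R \<omega>)" using int by simp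
  have meas: "(\<lambda>x. 1 / f x) \<in> borel_measurable borel" "?R \<in> borel_measurable M" by measurable
  have meas': "cvar M X Y \<in> borel_measurable M"
    unfolding cvar_def by (rule borel_measurable_cond_exp2)
  note [measurable] = meas'
  have "integrable M (\<lambda>\<omega>. cvar M X Y \<omega> / f (X \<omega>)) \<longleftrightarrow> integrable M (\<lambda>\<omega>. 1 / f (X \<omega>) * cexp M X ?R \<omega>)"
    by (rule integrable_cong_AE[OF _ _ eq]) measurable
  then show "integrable M (\<lambda>\<omega>. cvar M X Y \<omega> / f (X \<omega>))"
    using integrable_mult_cexp[OF X meas(2,1) int'] by blast
  have "expectation (\<lambda>\<omega>. cvar M X Y \<omega> / f (X \<omega>)) = expectation (\<lambda>\<omega>. 1 / f (X \<omega>) * cexp M X ?R \<omega>)"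
    by (rule integral_cong_AE[OF _ _ eq]) measurable
  also have "\<dots> = expectation (\<lambda>\<omega>. 1 / f (X \<omega>) * ?R \<omega>)"
    by (rule integral_mult_cexp[OF X meas(2,1) int'])
  finally show "expectation (\<lambda>\<omega>. cvar M X Y \<omega> / f (X \<omega>)) = expectation (\<lambda>\<omega>. ?R \<omega> / f (X \<omega>))"
    by simp
qed

lemma cprob_complement:
  fixes X :: "'a \<Rightarrow> real^'k" and D :: "'a \<Rightarrow> real"
  assumes X[measurable]: "X \<in> borel_measurable M" and D[measurable]: "D \<in> borel_measurable M"
    and D01: "AE \<omega> in M. D \<omega> \<in> {0, 1}"
  shows "AE \<omega> in M. cprob M X {\<omega>\<in>space M. D \<omega> = 0} \<omega> = 1 - cprob M X {\<omega>\<in>space M. D \<omega> = 1} \<omega>"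
proof -
  interpret sigma_finite_subalgebra M "vimage_algebra (space M) X borel"
    by (rule sigma_finite_subalgebra_vimage[OF X])
  let ?I = "\<lambda>v. indicator {\<omega>\<in>space M. D \<omega> = v} :: 'a \<Rightarrow> real"
  have "AE \<omega> in M. ?I 0 \<omega> = 1 - ?I 1 \<omega>"
    using D01 AE_space by eventually_elim (auto simp: indicator_def)
  then have "AE \<omega> in M. cexp M X (?I 0) \<omega> = cexp M X (\<lambda>\<omega>. 1 - ?I 1 \<omega>) \<omega>"
    by (rule real_cond_exp_cong) measurable
  moreover have "integrable M (?I 1)"
    by (rule integrable_const_bound[where B = 1]) auto
  then have "AE \<omega> in M. cexp M X (\<lambda>\<omega>. 1 - ?I 1 \<omega>) \<omega> = cexp M X (\<lambda>_. 1) \<omega> - cexp M X (?I 1) \<omega>"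
    by (intro real_cond_exp_diff) auto
  moreover have "AE \<omega> in M. cexp M X (\<lambda>_. 1) \<omega> = 1"
    by (rule real_cond_exp_F_meas) auto
  ultimately show ?thesis
    unfolding cprob_def by eventually_elim simp
qed

end

text \<open>\<open>\<pi>\<close> selects one potential outcome from the pair, so joint
  unconfoundedness serves both arms. The weight in \<open>int_X\<close> is symmetric in
  \<open>q\<close> and \<open>1 - q\<close>, so the same integrability assumption serves both as
  well.\<close>

lemma treatment_armI:
  fixes M :: "'a measure" and X :: "'a \<Rightarrow> real^'k" and D :: "'a \<Rightarrow> real" and Y :: "'a \<Rightarrow> real \<times> real" and \<pi> :: "real \<times> real \<Rightarrow> real"
  assumes sample: "iid_sample M borel Zs (\<lambda>\<omega>. (X \<omega>, D \<omega>, Y \<omega>))"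
    and X[measurable]: "X \<in> borel_measurable M" and D[measurable]: "D \<in> borel_measurable M"
    and Y[measurable]: "Y \<in> borel_measurable M"
    and q[measurable]: "q \<in> borel_measurable borel" and w[measurable]: "w \<in> borel_measurable borel"
    and \<pi>[measurable]: "\<pi> \<in> borel_measurable borel"
    and indep: "cond_indep M X Y D"
    and w_ind: "AE \<omega> in M. w (D \<omega>) = indicator {t} (D \<omega>)"
    and q01: "AE \<omega> in M. 0 < q (X \<omega>) \<and> q (X \<omega>) < 1"
    and propensity: "AE \<omega> in M. q (X \<omega>) = cprob M X {\<omega>\<in>space M. D \<omega> = t} \<omega>"
    and int_X: "integrable M (\<lambda>\<omega>. (1 + (norm (X \<omega>))\<^sup>2) / (q (X \<omega>) * (1 - q (X \<omega>))))"
    and int_Y: "integrable M (\<lambda>\<omega>. (\<pi> (Y \<omega>))\<^sup>2 / q (X \<omega>))"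
    and mean: "AE \<omega> in M. cexp M X (\<lambda>\<omega>. \<pi> (Y \<omega>)) \<omega> = \<alpha> + c \<bullet> X \<omega>"
  shows "treatment_arm M Zs (\<lambda>\<omega>. (X \<omega>, D \<omega>, Y \<omega>)) q (\<lambda>z. w (fst (snd z))) (\<lambda>z. \<pi> (snd (snd z))) \<alpha> c"
proof -
  interpret iid_sample M borel Zs "\<lambda>\<omega>. (X \<omega>, D \<omega>, Y \<omega>)" by (rule sample)
  have int_X': "integrable M (\<lambda>\<omega>. (1 + (norm (X \<omega>))\<^sup>2) / q (X \<omega>))"
  proof (rule Bochner_Integration.integrable_bound[OF int_X])
    show "AE \<omega> in M. norm ((1 + (norm (X \<omega>))\<^sup>2) / q (X \<omega>)) \<le>
        norm ((1 + (norm (X \<omega>))\<^sup>2) / (q (X \<omega>) * (1 - q (X \<omega>))))"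
      using q01
    proof eventually_elim
      case (elim \<omega>)
      have "(1 + (norm (X \<omega>))\<^sup>2) / q (X \<omega>) \<le> (1 + (norm (X \<omega>))\<^sup>2) / (q (X \<omega>) * (1 - q (X \<omega>)))"
        using elim by (intro divide_left_mono) (auto simp: mult_le_cancel_left1)
      then show ?case using elim by simp
    qed
  qed measurable
  have weighting:
    "integrable M (\<lambda>\<omega>. w (D \<omega>) / q (X \<omega>) * g (X \<omega>, \<pi> (Y \<omega>))) \<longleftrightarrow> integrable M (\<lambda>\<omega>. g (X \<omega>, \<pi> (Y \<omega>)))"
    "expectation (\<lambda>\<omega>. w (D \<omega>) / q (X \<omega>) * g (X \<omega>, \<pi> (Y \<omega>))) = expectation (\<lambda>\<omega>. g (X \<omega>, \<pi> (Y \<omega>)))"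
    if [measurable]: "g \<in> borel_measurable borel" for g :: "(real^'k) \<times> real \<Rightarrow> real"
  proof -
    let ?g = "\<lambda>z. g (fst z, \<pi> (snd z))"
    have g: "?g \<in> borel_measurable borel" by measurable
    have B: "{t} \<in> sets borel" by simp
    have propensity': "AE \<omega> in M. q (X \<omega>) = cprob M X {\<omega>\<in>space M. D \<omega> \<in> {t}} \<omega>"
      using propensity by simp
    have eq: "AE \<omega> in M. w (D \<omega>) / q (X \<omega>) * g (X \<omega>, \<pi> (Y \<omega>)) =
        indicator {t} (D \<omega>) / q (X \<omega>) * ?g (X \<omega>, Y \<omega>)"
      using w_ind by eventually_elim simp
    note weighting = integrable_propensity_weighting[OF X Y D indep B q q01 propensity' g]
      integral_propensity_weighting[OF X Y D indep B q q01 propensity' g]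
    have "integrable M (\<lambda>\<omega>. w (D \<omega>) / q (X \<omega>) * g (X \<omega>, \<pi> (Y \<omega>))) \<longleftrightarrow>
        integrable M (\<lambda>\<omega>. indicator {t} (D \<omega>) / q (X \<omega>) * ?g (X \<omega>, Y \<omega>))"
      by (rule integrable_cong_AE[OF _ _ eq]) measurable
    then show "integrable M (\<lambda>\<omega>. w (D \<omega>) / q (X \<omega>) * g (X \<omega>, \<pi> (Y \<omega>))) \<longleftrightarrow>
        integrable M (\<lambda>\<omega>. g (X \<omega>, \<pi> (Y \<omega>)))"
      using weighting(1) by simp
    have "expectation (\<lambda>\<omega>. w (D \<omega>) / q (X \<omega>) * g (X \<omega>, \<pi> (Y \<omega>))) =
        expectation (\<lambda>\<omega>. indicator {t} (D \<omega>) / q (X \<omega>) * ?g (X \<omega>, Y \<omega>))"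
      by (rule integral_cong_AE[OF _ _ eq]) measurable
    then show "expectation (\<lambda>\<omega>. w (D \<omega>) / q (X \<omega>) * g (X \<omega>, \<pi> (Y \<omega>))) = expectation (\<lambda>\<omega>. g (X \<omega>, \<pi> (Y \<omega>)))"
      using weighting(2) by simp
  qed
  have regression: "expectation (\<lambda>\<omega>. f (X \<omega>) * \<pi> (Y \<omega>)) = expectation (\<lambda>\<omega>. f (X \<omega>) * (\<alpha> + c \<bullet> X \<omega>))"
    if [measurable]: "f \<in> borel_measurable borel" and int: "integrable M (\<lambda>\<omega>. f (X \<omega>) * \<pi> (Y \<omega>))" for f
  proof -
    have "expectation (\<lambda>\<omega>. f (X \<omega>) * \<pi> (Y \<omega>)) = expectation (\<lambda>\<omega>. f (X \<omega>) * cexp M X (\<lambda>\<omega>. \<pi> (Y \<omega>)) \<omega>)"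
      by (rule integral_mult_cexp[symmetric]) (use int in measurable)
    also have "\<dots> = expectation (\<lambda>\<omega>. f (X \<omega>) * (\<alpha> + c \<bullet> X \<omega>))"
    proof (rule integral_cong_AE)
      show "AE \<omega> in M. f (X \<omega>) * cexp M X (\<lambda>\<omega>. \<pi> (Y \<omega>)) \<omega> = f (X \<omega>) * (\<alpha> + c \<bullet> X \<omega>)"
        using mean by eventually_elim simp
    qed measurable
    finally show ?thesis .
  qed
  show ?thesis
  proof (unfold_locales, goal_cases)
    \<comment> \<open>Cases 4, 6 and 9 are \<open>w01\<close>, \<open>integrable_dominating\<close>
      and \<open>regression\<close>.\<close>
    case 4
    show ?case using w_ind by eventually_elim (auto simp: indicator_def)
  next
    case 6
    have "integrable M (\<lambda>\<omega>. (1 + (norm (X \<omega>))\<^sup>2) / q (X \<omega>) + (\<pi> (Y \<omega>))\<^sup>2 / q (X \<omega>))"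
      by (intro Bochner_Integration.integrable_add int_X' int_Y)
    then show ?case by (simp add: add_divide_distrib)
  next
    case (9 f)
    then show ?case using regression[of f] by simp
  qed (use q01 weighting in simp_all)
qed

theorem theorem8:
  fixes M :: "'a measure"
    and X :: "'a \<Rightarrow> real^'k" and D YT YC :: "'a \<Rightarrow> real"
    and Xs :: "nat \<Rightarrow> 'a \<Rightarrow> real^'k" and Ds YTs YCs :: "nat \<Rightarrow> 'a \<Rightarrow> real"
    and p :: "real^'k \<Rightarrow> real"
    and a b :: real and c :: "real^'k"
  assumes "prob_space M"
    and "X \<in> borel_measurable M" "D \<in> borel_measurable M"
        "YT \<in> borel_measurable M" "YC \<in> borel_measurable M"
    and "AE \<omega> in M. D \<omega> \<in> {0, 1}"
    and sample: "iid_copies M borel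
           (\<lambda>i \<omega>. (Xs i \<omega>, Ds i \<omega>, YTs i \<omega>, YCs i \<omega>)) (\<lambda>\<omega>. (X \<omega>, D \<omega>, YT \<omega>, YC \<omega>))"
    and unconfoundedness: "cond_indep M X (\<lambda>\<omega>. (YT \<omega>, YC \<omega>)) D"
    and "p \<in> borel_measurable borel"
    and propensity: "AE \<omega> in M. p (X \<omega>) = cprob M X {\<omega>\<in>space M. D \<omega> = 1} \<omega>"
    and overlap: "AE \<omega> in M. 0 < p (X \<omega>) \<and> p (X \<omega>) < 1"
    and "integrable M (\<lambda>\<omega>. (1 + (norm (X \<omega>))\<^sup>2) / (p (X \<omega>) * (1 - p (X \<omega>))))"
    and "integrable M (\<lambda>\<omega>. (YT \<omega>)\<^sup>2 / p (X \<omega>))"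
    and "integrable M (\<lambda>\<omega>. (YC \<omega>)\<^sup>2 / (1 - p (X \<omega>)))"
    and "invertible (integral\<^sup>L M (\<lambda>\<omega>.
           outer (X \<omega> - integral\<^sup>L M X) /\<^sub>R (p (X \<omega>) * (1 - p (X \<omega>)))))"
    and "AE \<omega> in M. cexp M X YT \<omega> = a + b + c \<bullet> X \<omega>"
    and "AE \<omega> in M. cexp M X YC \<omega> = a + c \<bullet> X \<omega>"
  shows "integrable M (efficiency_integrand M p X YT YC) \<and>
    has_asymptotic_variance M
      (\<lambda>n \<omega>. beta_lm p n (\<lambda>i. Xs i \<omega>) (\<lambda>i. Ds i \<omega>) (\<lambda>i. YTs i \<omega>) (\<lambda>i. YCs i \<omega>))
      (avg_effect M YT YC) (efficiency_bound M p X YT YC)"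
proof -
  note [measurable] = assms(2-5) assms(9)
  note D01 = assms(6) and int_X = assms(12) and int_YT = assms(13) and int_YC = assms(14)
    and mean_T = assms(16) and mean_C = assms(17)
  interpret prob_space M by fact
  let ?Zs = "\<lambda>i \<omega>. (Xs i \<omega>, Ds i \<omega>, YTs i \<omega>, YCs i \<omega>)" and ?Z = "\<lambda>\<omega>. (X \<omega>, D \<omega>, YT \<omega>, YC \<omega>)"
  have Z: "?Z \<in> borel_measurable M" by measurable
  have Y: "(\<lambda>\<omega>. (YT \<omega>, YC \<omega>)) \<in> borel_measurable M" by measurable
  interpret S: iid_sample M borel ?Zs ?Z
    by unfold_locales (rule sample, rule Z)
  \<comment> \<open>\<open>id\<close> displays the weight as a function applied to the indicator, as
    in the conclusion of \<open>treatment_armI\<close>; it is simplified away at the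
    interpretation.\<close>
  have armT: "treatment_arm M ?Zs ?Z p (\<lambda>z. id (fst (snd z))) (\<lambda>z. fst (snd (snd z))) (a + b) c"
  proof (rule treatment_armI[OF S.iid_sample_axioms assms(2,3) Y assms(9) _ _ unconfoundedness _ overlap propensity int_X])
    show "AE \<omega> in M. id (D \<omega>) = indicator {1} (D \<omega>)"
      using D01 by eventually_elim (auto simp: indicator_def)
  qed (use int_YT mean_T in \<open>simp_all\<close>)
  have armC: "treatment_arm M ?Zs ?Z (\<lambda>x. 1 - p x) (\<lambda>z. 1 - fst (snd z)) (\<lambda>z. snd (snd (snd z))) a c"
  proof (rule treatment_armI[OF S.iid_sample_axioms assms(2,3) Y _ _ _ unconfoundedness, where t = 0 and w = "\<lambda>d. 1 - d"])
    show "AE \<omega> in M. 1 - D \<omega> = indicator {0} (D \<omega>)"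
      using D01 by eventually_elim (auto simp: indicator_def)
    show "AE \<omega> in M. 1 - p (X \<omega>) = cprob M X {\<omega>\<in>space M. D \<omega> = 0} \<omega>"
      using propensity cprob_complement[OF assms(2,3) D01] by eventually_elim simp
    show "AE \<omega> in M. 0 < 1 - p (X \<omega>) \<and> 1 - p (X \<omega>) < 1"
      using overlap by eventually_elim simp
  qed (use int_X int_YC mean_C in \<open>simp_all add: mult.commute\<close>)
  interpret T: treatment_arm M ?Zs ?Z p "\<lambda>z. fst (snd z)" "\<lambda>z. fst (snd (snd z))" "a + b" c
    using armT by simp
  interpret C: treatment_arm M ?Zs ?Z "\<lambda>x. 1 - p x" "\<lambda>z. 1 - fst (snd z)" "\<lambda>z. snd (snd (snd z))" a c
    by (rule armC)
  interpret two_arms M ?Zs ?Z p "a + b" a c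
    by unfold_locales (use int_X assms(15) in \<open>simp_all add: T.\<mu>_def\<close>)
  \<comment> \<open>The two mean outcomes share the term \<open>c \<bullet> T.\<mu>\<close>, so only
    the intercepts \<open>a + b\<close> and \<open>a\<close> remain in the difference.\<close>
  have effect: "avg_effect M YT YC = b"
    using T.expectation_outcome C.expectation_outcome by (simp add: avg_effect_def)
  let ?VT = "\<lambda>\<omega>. (YT \<omega> - (a + b + c \<bullet> X \<omega>))\<^sup>2 / p (X \<omega>)"
  let ?VC = "\<lambda>\<omega>. (YC \<omega> - (a + c \<bullet> X \<omega>))\<^sup>2 / (1 - p (X \<omega>))"
  have resT: "integrable M ?VT" and resC: "integrable M ?VC"
    using T.integrable_residual_square C.integrable_residual_square
    by (simp_all add: T.residual_def C.residual_def)
  have meas: "(\<lambda>x. a + b + c \<bullet> x) \<in> borel_measurable borel" "(\<lambda>x. a + c \<bullet> x) \<in> borel_measurable borel"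
    "(\<lambda>x. 1 - p x) \<in> borel_measurable borel"
    by measurable
  note cvarT = integrable_cvar_divide[OF assms(2,4,9) meas(1) mean_T resT]
    expectation_cvar_divide[OF assms(2,4,9) meas(1) mean_T resT]
  note cvarC = integrable_cvar_divide[OF assms(2,5) meas(3,2) mean_C resC]
    expectation_cvar_divide[OF assms(2,5) meas(3,2) mean_C resC]
  let ?W = "\<lambda>\<omega>. cvar M X YT \<omega> / p (X \<omega>) + cvar M X YC \<omega> / (1 - p (X \<omega>))"
  have eff: "AE \<omega> in M. efficiency_integrand M p X YT YC \<omega> = ?W \<omega>"
    using mean_T mean_C by eventually_elim (simp add: efficiency_integrand_def effect)
  have int_W: "integrable M ?W"
    by (rule Bochner_Integration.integrable_add[OF cvarT(1) cvarC(1)])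
  have eff_meas: "efficiency_integrand M p X YT YC \<in> borel_measurable M"
    unfolding efficiency_integrand_def[abs_def] cvar_def by measurable
  \<comment> \<open>This shows that the efficiency bound is a genuine expectation and not the
    default value of the integral of a function that is not integrable.\<close>
  have int_eff: "integrable M (efficiency_integrand M p X YT YC)"
    using integrable_cong_AE[OF eff_meas borel_measurable_integrable[OF int_W] eff] int_W by simp
  have "efficiency_bound M p X YT YC = integral\<^sup>L M ?W"
    unfolding efficiency_bound_def
    by (rule integral_cong_AE[OF eff_meas borel_measurable_integrable[OF int_W] eff])
  also have "\<dots> = integral\<^sup>L M ?VT + integral\<^sup>L M ?VC"
    unfolding Bochner_Integration.integral_add[OF cvarT(1) cvarC(1)] cvarT(2) cvarC(2) ..
  finally have bound: "efficiency_bound M p X YT YC = integral\<^sup>L M ?VT + integral\<^sup>L M ?VC" .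
  have "AE \<omega> in M. 0 \<le> ?VT \<omega>" "AE \<omega> in M. 0 \<le> ?VC \<omega>"
    using overlap by (eventually_elim, simp)+
  then have nonneg: "0 \<le> efficiency_bound M p X YT YC"
    unfolding bound by (intro add_nonneg_nonneg integral_nonneg_AE)
  have "weak_conv_m
      (\<lambda>n. distr M borel (\<lambda>\<omega>. sqrt (real n) *
        (beta_lm p n (\<lambda>i. Xs i \<omega>) (\<lambda>i. Ds i \<omega>) (\<lambda>i. YTs i \<omega>) (\<lambda>i. YCs i \<omega>) - avg_effect M YT YC)))
      (centered_normal (efficiency_bound M p X YT YC))"
    using estimator_asymptotically_normal
    by (simp add: bound effect T.residual_def C.residual_def)
  moreover have "(\<lambda>\<omega>. beta_lm p n (\<lambda>i. Xs i \<omega>) (\<lambda>i. Ds i \<omega>) (\<lambda>i. YTs i \<omega>) (\<lambda>i. YCs i \<omega>)) \<in> borel_measurable M" for n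
    using estimator_measurable[of n] by simp
  ultimately show ?thesis
    using int_eff nonneg by (simp add: has_asymptotic_variance_def)
qed

end
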